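(* Let $B_1=B_1(0)\subset\mathbb{R}^n$ be the open unit ball. Let $\psi\in C^1(B_1)$ be such that $\phi:=\psi-(n-2)\frac{\pi}{2}\ge0$ on $B_1$, and suppose that $\phi$ is a viscosity supersolution of the infinity-Laplace equation on $B_1$, i.e. $$\sum_{i,j=1}^n\phi_{ij}\phi_i\phi_j\le0\quad\text{in }B_1\text{ in the viscosity sense}.$$ Let $u\in C^3(\overline{B_1})$ be a solution of $$\sum_{i=1}^n\arctan\lambda_i(x)=\psi(x),\qquad x\in B_1,$$ where $\lambda_1(x),\dots,\lambda_n(x)$ are the eigenvalues of the Hessian $D^2u(x)$. Then $$|Du(0)|\le C(n)\left(1+\operatorname{osc}_{B_1}u\right),$$ where the constant $C(n)$ depends only on $n$.
   Context: $\operatorname{osc}_{B_1}u=\sup_{B_1}u-\inf_{B_1}u$. A continuous function $\phi$ is a viscosity supersolution of the infinity-Laplace equation in $B_1$ if, whenever $x_0\in B_1$, $P$ is a $C^2$ function near $x_0$, and $\phi-P$ has a local minimum at $x_0$, one has $D^2P(x_0)(DP(x_0),DP(x_0))=\sum_{i,j}P_{ij}(x_0)P_i(x_0)P_j(x_0)\le0$. *)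

theory Defs
  imports "HOL-Analysis.Analysis" "HOL-Computational_Algebra.Polynomial"
begin

definition partial_deriv :: "'n \<Rightarrow> (real^'n \<Rightarrow> real) \<Rightarrow> real^'n::finite \<Rightarrow> real" where
  "partial_deriv i f x = frechet_derivative f (at x) (axis i 1)"

(* iter_partial [i, j, ..., l] f = d_i (d_j (... (d_l f))) *)
definition iter_partial :: "'n list \<Rightarrow> (real^'n::finite \<Rightarrow> real) \<Rightarrow> real^'n \<Rightarrow> real" where
  "iter_partial is f = foldr partial_deriv is f"

definition gradient :: "(real^'n::finite \<Rightarrow> real) \<Rightarrow> real^'n \<Rightarrow> real^'n" where
  "gradient f x = (\<chi> i. partial_deriv i f x)"

definition hessian :: "(real^'n::finite \<Rightarrow> real) \<Rightarrow> real^'n \<Rightarrow> real^'n^'n" where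
  "hessian f x = (\<chi> i j. iter_partial [i, j] f x)"

(* The class C^k(S), for open S. *)
definition Ck_on :: "nat \<Rightarrow> (real^'n::finite \<Rightarrow> real) \<Rightarrow> (real^'n) set \<Rightarrow> bool" where
  "Ck_on k f S \<longleftrightarrow>
     (\<forall>is. length is < k \<longrightarrow> (\<forall>x\<in>S. iter_partial is f differentiable (at x))) \<and>
     (\<forall>is. length is \<le> k \<longrightarrow> continuous_on S (iter_partial is f))"

(* The class C^k of the closure of an open set S: f is C^k in S and f as well as its partial
   derivatives of order up to k extend continuously from S to the closure.  The extensions g are
   needed because the Frechet derivative of f at a boundary point depends on the values of f
   outside the closure. *)
definition Ck_closure :: "nat \<Rightarrow> (real^'n::finite \<Rightarrow> real) \<Rightarrow> (real^'n) set \<Rightarrow> bool" where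
  "Ck_closure k f S \<longleftrightarrow>
     Ck_on k f S \<and> continuous_on (closure S) f \<and>
     (\<forall>is. length is \<le> k \<longrightarrow>
        (\<exists>g. continuous_on (closure S) g \<and> (\<forall>x\<in>S. g x = iter_partial is f x)))"

definition charpoly :: "real^'n^'n::finite \<Rightarrow> real poly" where
  "charpoly A = det (mat [:0, 1:] - (\<chi> i j. [:A $ i $ j:]))"

lemma poly_charpoly: "poly (charpoly A) t = det (mat t - A)"
  unfolding charpoly_def det_def
  by (simp add: poly_sum poly_prod mat_def if_distrib[where f = "\<lambda>p. poly p t"] cong: if_cong)

(* The real eigenvalues, counted with algebraic multiplicity. For a symmetric matrix these are
   all the eigenvalues. *)
definition eigenvalues :: "real^'n^'n::finite \<Rightarrow> real multiset" where
  "eigenvalues A = proots (charpoly A)"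

definition infinity_supersolution :: "(real^'n::finite \<Rightarrow> real) \<Rightarrow> (real^'n) set \<Rightarrow> bool" where
  "infinity_supersolution \<phi> S \<longleftrightarrow>
     continuous_on S \<phi> \<and>
     (\<forall>x0\<in>S. \<forall>P. (\<exists>r>0. Ck_on 2 P (ball x0 r)) \<longrightarrow>
        (\<exists>r>0. \<forall>y\<in>S \<inter> ball x0 r. \<phi> x0 - P x0 \<le> \<phi> y - P y) \<longrightarrow>
        (\<Sum>i\<in>UNIV. \<Sum>j\<in>UNIV.
           hessian P x0 $ i $ j * gradient P x0 $ i * gradient P x0 $ j) \<le> 0)"

definition osc :: "'a set \<Rightarrow> ('a \<Rightarrow> real) \<Rightarrow> real" where
  "osc S u = (SUP x\<in>S. u x) - (INF x\<in>S. u x)"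

end

theory Submission
  imports Defs
begin

text \<open>
  The estimate follows from the maximum principle for
  \<open>w = \<eta> |Du| + (n/M) u\<^sup>2\<close> with \<open>\<eta>(x) = 1/4 - |x|\<^sup>2\<close> on the ball of radius \<open>1/2\<close>, where \<open>M = 1 + osc u\<close>
  and \<open>u\<close> has been shifted by a constant so that \<open>M \<le> u \<le> 2 M\<close>.  It suffices to bound \<open>\<eta> |Du|\<close>
  by a multiple of \<open>M\<close> at a maximum point of \<open>w\<close>: then \<open>w\<close> is bounded by a multiple of \<open>M\<close>, and
  \<open>|Du(0)| \<le> 4 w(0)\<close>.

  At an interior maximum, the condition \<open>Dw = 0\<close> reads
  \<open>\<eta> D\<^sup>2u \<nu> = - |Du| (D\<eta> + 2 (n/M) u \<nu>)\<close> with \<open>\<nu> = Du/|Du|\<close>.  Since \<open>(n/M) u \<ge> n\<close> and \<open>|D\<eta>| \<le> 1\<close>,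
  the second term fixes the sign: \<open>D\<^sup>2u\<close> has an eigenvalue \<open>-m\<close> with \<open>m\<close> comparable to
  \<open>|Du|/\<eta>\<close>.  As the phase is at least \<open>(n - 2) \<pi>/2\<close>, the other eigenvalues are at
  least \<open>m\<close>, so that \<open>1/(1 + m\<^sup>2)\<close> is the largest coefficient of the linearized operator
  \<open>F\<^sub>i\<^sub>j = ((I + (D\<^sup>2u)\<^sup>2)\<^sup>-\<^sup>1)\<^sub>i\<^sub>j\<close>, and moreover \<open>\<phi> \<le> 1/m\<close> (\<open>negative_eigenvalue_phase\<close>).
  In \<open>F\<^sub>i\<^sub>j w\<^sub>i\<^sub>j \<le> 0\<close> the term \<open>F\<^sub>i\<^sub>j u\<^sub>i u\<^sub>j / M\<close> then outweighs all others if \<open>\<eta> |Du|\<close> is large compared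
  with \<open>M\<close> (\<open>critical_point_estimate\<close>).

  The one term of different nature is \<open>\<eta> \<psi>\<^sub>\<nu>\<close>, which arises from the differentiated equation
  \<open>F\<^sub>i\<^sub>j u\<^sub>i\<^sub>j\<^sub>\<nu> = \<psi>\<^sub>\<nu>\<close>.  Here the supersolution property enters: a nonnegative infinity-superharmonic
  function lies above cones, so \<open>|D\<phi>| \<le> 4 \<phi>\<close> on the ball of radius \<open>1/2\<close>
  (\<open>infinity_supersolution_gradient\<close>).  With \<open>\<phi> \<le> 1/m\<close> the term is at least \<open>-4 \<eta>/m\<close>, which is
  small enough.

  Two devices avoid differentiating functions that are not smooth.  The norm \<open>|Du|\<close> is replaced
  by \<open>Du \<bullet> \<nu>\<close> with \<open>\<nu>\<close> frozen at the maximum point (\<open>interior_maximum_bound\<close>).  The equation is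
  differentiated through \<open>det (I + \<i> D\<^sup>2u)\<close>, whose argument is the phase, instead of through
  individual eigenvalues (\<open>phase_derivative\<close>).
\<close>

section \<open>Diagonalization of symmetric matrices\<close>

text \<open>The eigenvector maximizes the Rayleigh quotient on the unit sphere of the subspace.  Testing
  maximality in the direction of the residual \<open>r = f e - l e\<close> gives
  \<open>2 t |r|\<^sup>2 = O(t\<^sup>2)\<close>, so \<open>r = 0\<close>.\<close>
lemma selfadjoint_eigenvector_in_subspace:
  fixes f :: "'a::euclidean_space \<Rightarrow> 'a"
  assumes lin: "linear f" and sa: "\<And>x y. f x \<bullet> y = x \<bullet> f y"
    and S: "subspace S" and inv: "\<And>x. x \<in> S \<Longrightarrow> f x \<in> S" and ne: "S \<noteq> {0}"
  obtains e l where "e \<in> S" "norm e = 1" "f e = l *\<^sub>R e"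
proof -
  obtain z where z: "z \<in> S" "z \<noteq> 0" using ne subspace_0[OF S] by auto
  let ?K = "S \<inter> sphere 0 1"
  have K: "compact ?K"
    by (intro closed_Int_compact closed_subspace S compact_sphere)
  have "z /\<^sub>R norm z \<in> ?K"
    using z S by (simp add: subspace_scale)
  hence Kne: "?K \<noteq> {}" by blast
  have "continuous_on ?K (\<lambda>x. x \<bullet> f x)"
    by (intro continuous_intros linear_continuous_on linear_conv_bounded_linear[THEN iffD1, OF lin])
  then obtain e where e: "e \<in> S" "norm e = 1" and max: "\<And>x. x \<in> ?K \<Longrightarrow> x \<bullet> f x \<le> e \<bullet> f e"
    using continuous_attains_sup[OF K Kne] by fastforce
  define l where "l = e \<bullet> f e"
  have quad: "y \<bullet> f y \<le> l * (y \<bullet> y)" if y: "y \<in> S" for y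
  proof (cases "y = 0")
    case False
    have "y /\<^sub>R norm y \<in> ?K" using False y S by (simp add: subspace_scale)
    from max[OF this] have "(y \<bullet> f y) / (norm y)^2 \<le> l"
      by (simp add: l_def linear_scale[OF lin] power2_eq_square field_simps)
    thus ?thesis using False by (simp add: field_simps power2_norm_eq_inner)
  qed (simp add: linear_0[OF lin])
  define r where "r = f e - l *\<^sub>R e"
  have rS: "r \<in> S" unfolding r_def using e inv S by (simp add: subspace_diff subspace_scale)
  have ee: "e \<bullet> e = 1" using e by (simp add: norm_eq_1)
  have rf: "r \<bullet> f e = r \<bullet> r + l * (r \<bullet> e)"
    by (simp add: r_def inner_diff_right inner_diff_left inner_commute algebra_simps)
  have ineq: "2 * t * (r \<bullet> r) \<le> t^2 * (l * (r \<bullet> r) - r \<bullet> f r)" for t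
  proof -
    have "(e + t *\<^sub>R r) \<bullet> f (e + t *\<^sub>R r) \<le> l * ((e + t *\<^sub>R r) \<bullet> (e + t *\<^sub>R r))"
      by (intro quad) (simp add: e rS S subspace_add subspace_scale)
    moreover have "(e + t *\<^sub>R r) \<bullet> f (e + t *\<^sub>R r) = l + 2 * t * (r \<bullet> f e) + t^2 * (r \<bullet> f r)"
      using sa[of e r] by (simp add: l_def linear_add[OF lin] linear_scale[OF lin] inner_add_left
          inner_add_right power2_eq_square algebra_simps inner_commute)
    moreover have "(e + t *\<^sub>R r) \<bullet> (e + t *\<^sub>R r) = 1 + 2 * t * (r \<bullet> e) + t^2 * (r \<bullet> r)"
      by (simp add: inner_add_left inner_add_right power2_eq_square ee algebra_simps inner_commute)
    ultimately have "l + 2 * t * (r \<bullet> f e) + t^2 * (r \<bullet> f r)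
        \<le> l * (1 + 2 * t * (r \<bullet> e) + t^2 * (r \<bullet> r))" by metis
    thus ?thesis unfolding rf by (simp add: algebra_simps)
  qed
  have "r \<bullet> r = 0"
  proof (rule ccontr)
    assume "r \<bullet> r \<noteq> 0"
    hence c: "0 < r \<bullet> r" by simp
    define K where "K = l * (r \<bullet> r) - r \<bullet> f r"
    \<comment> \<open>small enough for the linear term of the inequality above to dominate the quadratic one\<close>
    define t where "t = (r \<bullet> r) / (\<bar>K\<bar> + 1)"
    have t: "0 < t" using c by (simp add: t_def)
    have "2 * t * (r \<bullet> r) \<le> t * (t * K)" using ineq[of t] by (simp add: K_def power2_eq_square)
    hence "2 * (r \<bullet> r) \<le> t * K" using t by (simp add: mult.assoc mult.left_commute)
    also have "\<dots> \<le> t * (\<bar>K\<bar> + 1)" using t by (intro mult_left_mono) auto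
    also have "\<dots> = r \<bullet> r" unfolding t_def
      by (smt (verit, best) abs_ge_zero nonzero_eq_divide_eq)
    finally show False using c by simp
  qed
  hence "f e = l *\<^sub>R e" by (simp add: r_def)
  with e that show ?thesis by blast
qed

text \<open>The orthogonal complement of a set of eigenvectors is invariant, so that any orthonormal
  set of fewer than \<open>dim\<close> eigenvectors can be enlarged.\<close>
lemma selfadjoint_orthonormal_eigenvectors:
  fixes f :: "'a::euclidean_space \<Rightarrow> 'a"
  assumes lin: "linear f" and sa: "\<And>x y. f x \<bullet> y = x \<bullet> f y"
  shows "k \<le> DIM('a) \<Longrightarrow> \<exists>B. finite B \<and> card B = k \<and> pairwise orthogonal B \<and>
     (\<forall>b\<in>B. norm b = 1 \<and> (\<exists>l. f b = l *\<^sub>R b))"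
proof (induction k)
  case 0
  show ?case by (intro exI[of _ "{}"]) auto
next
  case (Suc k)
  then obtain B where B: "finite B" "card B = k" "pairwise orthogonal B"
    "\<And>b. b \<in> B \<Longrightarrow> norm b = 1" "\<And>b. b \<in> B \<Longrightarrow> \<exists>l. f b = l *\<^sub>R b" by auto
  define S where "S = {y. \<forall>b\<in>B. orthogonal b y}"
  have S: "subspace S" unfolding S_def by (simp add: subspace_orthogonal_to_vectors)
  have "dim B \<le> k" using dim_le_card'[OF B(1)] B(2) by simp
  hence "dim B < DIM('a)" using Suc.prems by simp
  then obtain z where "z \<noteq> 0" "\<And>y. y \<in> span B \<Longrightarrow> orthogonal z y"
    using orthogonal_to_subspace_exists[of B] by metis
  hence "z \<in> S" "z \<noteq> 0" by (auto simp: S_def orthogonal_commute span_base)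
  hence ne: "S \<noteq> {0}" by auto
  have inv: "f x \<in> S" if x: "x \<in> S" for x
    unfolding S_def
  proof safe
    fix b assume b: "b \<in> B"
    then obtain l where "f b = l *\<^sub>R b" using B(5) by blast
    moreover have "b \<bullet> x = 0" using x b by (auto simp: S_def orthogonal_def)
    ultimately have "b \<bullet> f x = 0" using sa[of b x] by simp
    thus "orthogonal b (f x)" by (simp add: orthogonal_def)
  qed
  obtain e l where e: "e \<in> S" "norm e = 1" "f e = l *\<^sub>R e"
    using selfadjoint_eigenvector_in_subspace[OF lin sa S inv ne] by blast
  have "e \<notin> B"
  proof
    assume "e \<in> B"
    hence "orthogonal e e" using e(1) by (simp add: S_def)
    thus False using e(2) by (simp add: orthogonal_def)
  qed
  thus ?case using B e
    by (intro exI[of _ "insert e B"]) (auto simp: pairwise_insert S_def orthogonal_commute)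
qed

lemma symmetric_matrix_eigenbasis:
  fixes A :: "real^'n^'n"
  assumes sym: "\<And>i j. A $ i $ j = A $ j $ i"
  shows "\<exists>(e :: 'n \<Rightarrow> real^'n) l. (\<forall>i j. e i \<bullet> e j = (if i = j then 1 else 0)) \<and>
     (\<forall>i. A *v e i = l i *\<^sub>R e i)"
proof -
  have tr: "transpose A = A" by (simp add: vec_eq_iff transpose_def sym)
  have sa: "(A *v x) \<bullet> y = x \<bullet> (A *v y)" for x y
    using dot_lmul_matrix[of x A y] tr by (metis transpose_matrix_vector)
  obtain B :: "(real^'n) set" where B: "finite B" "card B = DIM(real^'n)" "pairwise orthogonal B"
    "\<And>b. b \<in> B \<Longrightarrow> norm b = 1" "\<And>b. b \<in> B \<Longrightarrow> \<exists>l. A *v b = l *\<^sub>R b"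
    using selfadjoint_orthonormal_eigenvectors[OF matrix_vector_mul_linear sa, of "DIM(real^'n)"] by auto
  have "card (UNIV :: 'n set) = card B" using B(2) by simp
  then obtain e where e: "bij_betw e (UNIV :: 'n set) B"
    using finite_same_card_bij[of "UNIV :: 'n set" B] B(1) by auto
  have eB: "e i \<in> B" for i using e by (auto simp: bij_betw_def)
  have inj: "e i = e j \<longleftrightarrow> i = j" for i j using e by (auto simp: bij_betw_def inj_on_def)
  have on: "e i \<bullet> e j = (if i = j then 1 else 0)" for i j
    using B(3) B(4)[OF eB, of i] eB[of i] eB[of j] inj[of i j]
    by (auto simp: pairwise_def orthogonal_def norm_eq_1)
  obtain l where "\<And>i. A *v e i = l i *\<^sub>R e i" using B(5)[OF eB] by metis
  with on show ?thesis by blast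
qed

lemma orthonormal_expansion:
  fixes e :: "'n \<Rightarrow> real^'n"
  assumes on: "\<And>i j. e i \<bullet> e j = (if i = j then 1 else 0)"
  shows "(\<Sum>k\<in>UNIV. (e k \<bullet> x) * (e k \<bullet> y)) = x \<bullet> y"
proof -
  define E where "E = (\<chi> k. e k)"
  have "E ** transpose E = mat 1"
    using on by (simp add: E_def vec_eq_iff matrix_matrix_mult_def transpose_def mat_def inner_vec_def)
  hence "orthogonal_matrix E"
    by (metis orthogonal_matrix orthogonal_matrix_transpose transpose_transpose)
  hence "orthogonal_transformation (\<lambda>x. E *v x)"
    by (simp add: orthogonal_transformation_matrix matrix_vector_mul_linear)
  hence "(E *v x) \<bullet> (E *v y) = x \<bullet> y" by (simp add: orthogonal_transformation_def)
  moreover have "(E *v x) $ k = e k \<bullet> x" for k x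
    by (simp add: E_def matrix_vector_mul_component)
  ultimately show ?thesis by (simp add: inner_vec_def)
qed

text \<open>Allowing a coefficient ring other than the reals makes one computation serve the
  characteristic polynomial (with \<open>h\<close> the embedding of constants) and the complex determinant
  \<open>det (I + \<i>A)\<close>.\<close>
lemma det_orthonormal_conjugation:
  fixes e :: "'n \<Rightarrow> real^'n" and h :: "real \<Rightarrow> 'r::comm_ring_1" and A :: "real^'n^'n"
  assumes on: "\<And>i j. e i \<bullet> e j = (if i = j then 1 else 0)"
    and h0: "h 0 = 0" and h1: "h 1 = 1" and hadd: "\<And>x y. h (x + y) = h x + h y"
    and hmul: "\<And>x y. h (x * y) = h x * h y"
  shows "det (\<chi> i j. (if i = j then a else 0) + b * h (A $ i $ j)) =
         det (\<chi> k l. (if k = l then a else 0) + b * h (e k \<bullet> (A *v e l)))"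
    (is "det ?X = det ?Y")
proof -
  have hsum: "h (sum f F) = (\<Sum>i\<in>F. h (f i))" if "finite F" for f :: "'n \<Rightarrow> real" and F
    using that by (induction rule: finite_induct) (auto simp: h0 hadd)
  define E :: "'r^'n^'n" where "E = (\<chi> k i. h (e k $ i))"
  have inn: "h (x \<bullet> y) = (\<Sum>i\<in>UNIV. h (x $ i) * h (y $ i))" for x y :: "real^'n"
    by (simp add: inner_vec_def hsum hmul)
  have EE: "E ** transpose E = mat 1"
  proof -
    have "(\<Sum>i\<in>UNIV. h (e k $ i) * h (e l $ i)) = (if k = l then 1 else 0)" for k l
      unfolding inn[symmetric] on by (simp add: h0 h1)
    thus ?thesis by (simp add: E_def vec_eq_iff matrix_matrix_mult_def transpose_def mat_def)
  qed
  have "(E ** ?X ** transpose E) $ k $ l = ?Y $ k $ l" for k l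
  proof -
    have "(E ** ?X ** transpose E) $ k $ l
       = (\<Sum>j\<in>UNIV. (\<Sum>i\<in>UNIV. h (e k $ i) * ((if i = j then a else 0) + b * h (A $ i $ j))) * h (e l $ j))"
      by (simp add: E_def matrix_matrix_mult_def transpose_def)
    also have "\<dots> = (\<Sum>j\<in>UNIV. (h (e k $ j) * a + b * (\<Sum>i\<in>UNIV. h (e k $ i) * h (A $ i $ j))) * h (e l $ j))"
    proof (intro sum.cong refl arg_cong2[where f="(*)"])
      fix j
      have "(\<Sum>i\<in>UNIV. h (e k $ i) * ((if i = j then a else 0) + b * h (A $ i $ j)))
        = (\<Sum>i\<in>UNIV. (if i = j then h (e k $ i) * a else 0)) + (\<Sum>i\<in>UNIV. b * (h (e k $ i) * h (A $ i $ j)))"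
        unfolding sum.distrib[symmetric] by (intro sum.cong) (auto simp: algebra_simps)
      thus "(\<Sum>i\<in>UNIV. h (e k $ i) * ((if i = j then a else 0) + b * h (A $ i $ j)))
        = h (e k $ j) * a + b * (\<Sum>i\<in>UNIV. h (e k $ i) * h (A $ i $ j))"
        by (simp add: sum_distrib_left)
    qed
    also have "\<dots> = a * (\<Sum>j\<in>UNIV. h (e k $ j) * h (e l $ j))
         + b * (\<Sum>j\<in>UNIV. (\<Sum>i\<in>UNIV. h (e k $ i) * h (A $ i $ j)) * h (e l $ j))"
      by (simp add: algebra_simps sum.distrib sum_distrib_left)
    also have "(\<Sum>j\<in>UNIV. h (e k $ j) * h (e l $ j)) = h (e k \<bullet> e l)" by (simp add: inn)
    also have "(\<Sum>j\<in>UNIV. (\<Sum>i\<in>UNIV. h (e k $ i) * h (A $ i $ j)) * h (e l $ j)) = h (e k \<bullet> (A *v e l))"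
      unfolding inn matrix_vector_mult_def
      by (simp add: hsum hmul sum_distrib_left sum_distrib_right mult.assoc) (rule sum.swap)
    finally show ?thesis using on[of k l] by (simp add: h0 h1)
  qed
  hence Y: "?Y = E ** ?X ** transpose E" by (simp add: vec_eq_iff)
  have "det ?Y = det E * det ?X * det (transpose E)" unfolding Y det_mul ..
  also have "\<dots> = det ?X * det (E ** transpose E)" by (simp only: det_mul ac_simps)
  finally show ?thesis by (simp add: EE)
qed

lemma det_eigenbasis:
  fixes e :: "'n \<Rightarrow> real^'n" and h :: "real \<Rightarrow> 'r::comm_ring_1" and A :: "real^'n^'n"
  assumes on: "\<And>i j. e i \<bullet> e j = (if i = j then 1 else 0)"
    and eig: "\<And>i. A *v e i = l i *\<^sub>R e i"
    and h: "h 0 = 0" "h 1 = 1" "\<And>x y. h (x + y) = h x + h y" "\<And>x y. h (x * y) = h x * h y"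
  shows "det (\<chi> i j. (if i = j then a else 0) + b * h (A $ i $ j)) = (\<Prod>k\<in>UNIV. a + b * h (l k))"
proof -
  have "det (\<chi> k l'. (if k = l' then a else 0) + b * h (e k \<bullet> (A *v e l')))
      = (\<Prod>k\<in>UNIV. (\<chi> k l'. (if k = l' then a else 0) + b * h (e k \<bullet> (A *v e l'))) $ k $ k)"
    by (rule det_diagonal) (simp add: eig on h)
  also have "\<dots> = (\<Prod>k\<in>UNIV. a + b * h (l k))" by (simp add: eig on)
  finally show ?thesis by (rule trans[OF det_orthonormal_conjugation[OF on h]])
qed

text \<open>The eigenvalues are given as roots of the characteristic polynomial with algebraic multiplicity;
  for a symmetric matrix they are the entries of a diagonalization.\<close>
lemma eigenvalues_eigenbasis:
  fixes e :: "'n \<Rightarrow> real^'n" and A :: "real^'n^'n"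
  assumes on: "\<And>i j. e i \<bullet> e j = (if i = j then 1 else 0)"
    and eig: "\<And>i. A *v e i = l i *\<^sub>R e i"
  shows "eigenvalues A = image_mset l (mset_set UNIV)"
proof -
  have "mat [:0, 1:] - (\<chi> i j. [:A $ i $ j:]) =
     (\<chi> i j. (if i = j then [:0,1:] else 0) + (-1) * [:A $ i $ j:])"
    by (simp add: vec_eq_iff mat_def)
  hence "charpoly A = (\<Prod>k\<in>UNIV. [:0,1:] + (-1) * [:l k:])"
    unfolding charpoly_def
    using det_eigenbasis[OF on eig, of "\<lambda>x. [:x:]" "[:0,1:]" "-1"] by simp
  also have "\<dots> = (\<Prod>k\<in>UNIV. [:- l k, 1:])" by simp
  finally have "charpoly A = (\<Prod>k\<in>UNIV. [:- l k, 1:])" .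
  hence "eigenvalues A = (\<Sum>k\<in>UNIV. {#l k#})"
    unfolding eigenvalues_def by (simp add: proots_prod)
  also have "\<dots> = image_mset l (mset_set UNIV)"
  proof -
    have "(\<Sum>k\<in>F. {#l k#}) = image_mset l (mset_set F)" if "finite F" for F
      using that by (induction rule: finite_induct) auto
    thus ?thesis by simp
  qed
  finally show ?thesis .
qed

section \<open>The derivative of the Lagrangian phase\<close>

text \<open>A permutation other than the identity moves at least two points, so that its term in the
  Leibniz expansion vanishes to second order at a diagonal matrix.\<close>
lemma has_vector_derivative_det_diagonal:
  fixes B :: "real \<Rightarrow> complex^'n^'n" and B' :: "complex^'n^'n"
  assumes B': "\<And>k l. ((\<lambda>t. B t $ k $ l) has_vector_derivative B' $ k $ l) (at s)"
    and diag: "\<And>k l. k \<noteq> l \<Longrightarrow> B s $ k $ l = 0"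
  shows "((\<lambda>t. det (B t)) has_vector_derivative
     (\<Sum>k\<in>UNIV. B' $ k $ k * (\<Prod>j\<in>UNIV - {k}. B s $ j $ j))) (at s)"
proof -
  let ?P = "{p. p permutes (UNIV :: 'n set)}"
  let ?d = "\<lambda>p::'n\<Rightarrow>'n. of_int (sign p) * (\<Sum>k\<in>UNIV. B' $ k $ p k * (\<Prod>j\<in>UNIV - {k}. B s $ j $ p j)) :: complex"
  have "((\<lambda>t. \<Prod>k\<in>UNIV. B t $ k $ p k) has_derivative
     (\<lambda>y. \<Sum>k\<in>UNIV. (y *\<^sub>R B' $ k $ p k) * (\<Prod>j\<in>UNIV - {k}. B s $ j $ p j))) (at s)" for p :: "'n \<Rightarrow> 'n"
    by (rule has_derivative_prod) (use B' in \<open>simp add: has_vector_derivative_def\<close>)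
  hence "((\<lambda>t. \<Prod>k\<in>UNIV. B t $ k $ p k) has_vector_derivative
     (\<Sum>k\<in>UNIV. B' $ k $ p k * (\<Prod>j\<in>UNIV - {k}. B s $ j $ p j))) (at s)" for p :: "'n \<Rightarrow> 'n"
    by (simp add: has_vector_derivative_def scaleR_sum_right)
  hence D: "((\<lambda>t. det (B t)) has_vector_derivative (\<Sum>p\<in>?P. ?d p)) (at s)"
    unfolding det_def
    by (intro has_vector_derivative_sum has_vector_derivative_mult_right) auto
  have zero: "?d p = 0" if p: "p \<in> ?P - {id}" for p
  proof -
    have "(\<Prod>j\<in>UNIV - {k}. B s $ j $ p j) = 0" for k
    proof -
      obtain i where i: "p i \<noteq> i" using p by (auto simp: fun_eq_iff)
      have inj: "inj p" using p permutes_inj by blast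
      hence "p (p i) \<noteq> p i" using i by (simp add: inj_eq)
      with i obtain j where "j \<noteq> k" "p j \<noteq> j" by metis
      thus ?thesis using diag[of j "p j"] by (intro prod_zero) auto
    qed
    thus ?thesis by (simp only: mult_zero_right sum.neutral_const)
  qed
  have "(\<Sum>p\<in>?P. ?d p) = ?d id"
    using zero
    by (subst sum.mono_neutral_right[of ?P "{id}" ?d]) (auto simp: permutes_id)
  also have "\<dots> = (\<Sum>k\<in>UNIV. B' $ k $ k * (\<Prod>j\<in>UNIV - {k}. B s $ j $ j))" by (simp add: sign_id)
  finally show ?thesis using D by simp
qed

lemma one_plus_ii_polar: "1 + \<i> * complex_of_real x = of_real (sqrt (1 + x\<^sup>2)) * cis (arctan x)"
proof -
  have "sqrt (1 + x\<^sup>2) \<noteq> 0" by (metis power_one real_sqrt_sum_squares_eq_cancel sum_power2_eq_zero_iff zero_neq_one real_sqrt_eq_zero_cancel_iff)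
  thus ?thesis by (auto simp: complex_eq_iff cos_arctan sin_arctan)
qed

lemma prod_one_plus_ii_polar:
  "(\<Prod>k\<in>K. 1 + \<i> * complex_of_real (l k)) =
     of_real (\<Prod>k\<in>K. sqrt (1 + (l k)\<^sup>2)) * cis (\<Sum>k\<in>K. arctan (l k))"
  by (induction K rule: infinite_finite_induct) (auto simp: one_plus_ii_polar cis_mult ac_simps)

text \<open>The phase \<open>\<Sum> arctan \<lambda>\<^sub>k\<close> is the argument of \<open>det (I + \<i>H)\<close>, a polynomial in the entries
  of \<open>H\<close>.  This gives the derivative of the phase without differentiating the
  eigenvalues, which need not be differentiable where they coincide.\<close>
lemma phase_derivative:
  fixes H :: "real \<Rightarrow> real^'n^'n" and H' :: "real^'n^'n"
    and e :: "'n \<Rightarrow> real^'n" and l :: "'n \<Rightarrow> real" and \<theta> :: "real \<Rightarrow> real"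
  assumes sym: "\<forall>\<^sub>F t in nhds 0. \<forall>i j. H t $ i $ j = H t $ j $ i"
    and phase: "\<forall>\<^sub>F t in nhds 0. (\<Sum>l\<in>#eigenvalues (H t). arctan l) = \<theta> t"
    and H': "\<And>i j. ((\<lambda>t. H t $ i $ j) has_real_derivative H' $ i $ j) (at 0)"
    and \<theta>': "(\<theta> has_real_derivative \<theta>') (at 0)"
    and on: "\<And>i j. e i \<bullet> e j = (if i = j then 1 else 0)"
    and eig: "\<And>i. H 0 *v e i = l i *\<^sub>R e i"
  shows "(\<Sum>k\<in>UNIV. (e k \<bullet> (H' *v e k)) / (1 + (l k)\<^sup>2)) = \<theta>'"
proof -
  define D where "D t = det (\<chi> i j. (if i = j then 1 else 0) + \<i> * complex_of_real (H t $ i $ j))" for t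
  define B where "B t = (\<chi> i j. (if i = j then 1 else 0) + \<i> * complex_of_real (e i \<bullet> (H t *v e j)))" for t
  define B' where "B' = (\<chi> i j. \<i> * complex_of_real (e i \<bullet> (H' *v e j)))"
  have D_B: "D t = det (B t)" for t
    unfolding D_def B_def by (rule det_orthonormal_conjugation[OF on]) auto
  have polar: "\<forall>\<^sub>F t in nhds 0. \<exists>r. 0 < r \<and> D t = of_real r * cis (\<theta> t)"
    using sym phase
  proof eventually_elim
    case (elim t)
    have s: "H t $ i $ j = H t $ j $ i" for i j using elim(1) by blast
    obtain f :: "'n \<Rightarrow> real^'n" and m where f: "\<And>i j. f i \<bullet> f j = (if i = j then 1 else 0)" "\<And>i. H t *v f i = m i *\<^sub>R f i"
      using symmetric_matrix_eigenbasis[of "H t", OF s] by blast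
    have "\<theta> t = (\<Sum>k\<in>UNIV. arctan (m k))"
      using elim(2) by (simp add: eigenvalues_eigenbasis[OF f] image_mset.compositionality o_def sum_unfold_sum_mset)
    moreover have "D t = (\<Prod>k\<in>UNIV. 1 + \<i> * complex_of_real (m k))"
      unfolding D_def by (rule det_eigenbasis[OF f]) auto
    hence "D t = of_real (\<Prod>k\<in>UNIV. sqrt (1 + (m k)\<^sup>2)) * cis (\<Sum>k\<in>UNIV. arctan (m k))"
      by (simp only: prod_one_plus_ii_polar)
    moreover have "0 < (\<Prod>k\<in>(UNIV::'n set). sqrt (1 + (m k)\<^sup>2))"
      by (intro prod_pos) (simp add: add_pos_nonneg)
    ultimately show ?case by metis
  qed
  have entry: "((\<lambda>t. B t $ i $ j) has_vector_derivative B' $ i $ j) (at 0)" for i j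
  proof -
    have "((\<lambda>t. e i \<bullet> (H t *v e j)) has_real_derivative e i \<bullet> (H' *v e j)) (at 0)"
      unfolding inner_vec_def matrix_vector_mult_def inner_real_def vec_lambda_beta
      by (auto intro!: derivative_eq_intros H' simp: mult.commute)
    hence "((\<lambda>t. complex_of_real (e i \<bullet> (H t *v e j))) has_vector_derivative of_real (e i \<bullet> (H' *v e j))) (at 0)"
      by (rule has_vector_derivative_of_real)
    hence "((\<lambda>t. (if i = j then 1 else 0) + \<i> * complex_of_real (e i \<bullet> (H t *v e j))) has_vector_derivative
       0 + \<i> * of_real (e i \<bullet> (H' *v e j))) (at 0)"
      by (intro has_vector_derivative_add has_vector_derivative_const has_vector_derivative_mult_right)
    thus ?thesis by (simp add: B_def B'_def)
  qed
  have B0: "B 0 $ k $ k = 1 + \<i> * of_real (l k)" for k by (simp add: B_def eig on)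
  have nz: "1 + \<i> * complex_of_real x \<noteq> 0" for x by (auto simp: complex_eq_iff)
  define D' where "D' = (\<Sum>k\<in>UNIV. B' $ k $ k * (\<Prod>j\<in>UNIV - {k}. B 0 $ j $ j))"
  have dD: "(D has_vector_derivative D') (at 0)"
    unfolding D_B D'_def
    by (rule has_vector_derivative_det_diagonal[OF entry]) (simp add: B_def eig on)
  have D0: "D 0 = (\<Prod>k\<in>UNIV. B 0 $ k $ k)"
    unfolding D_B by (rule det_diagonal) (simp add: B_def eig on)
  define T where "T = (\<Sum>k\<in>UNIV. B' $ k $ k / B 0 $ k $ k)"
  have D'T: "D' = D 0 * T"
    unfolding D'_def T_def D0 sum_distrib_left
  proof (intro sum.cong refl)
    fix k :: 'n
    have "(\<Prod>j\<in>UNIV. B 0 $ j $ j) = B 0 $ k $ k * (\<Prod>j\<in>UNIV - {k}. B 0 $ j $ j)"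
      by (rule prod.remove) auto
    thus "B' $ k $ k * (\<Prod>j\<in>UNIV - {k}. B 0 $ j $ j) = (\<Prod>j\<in>UNIV. B 0 $ j $ j) * (B' $ k $ k / B 0 $ k $ k)"
      using nz[of "l k"] by (simp add: B0)
  qed
  have ImT: "Im T = (\<Sum>k\<in>UNIV. (e k \<bullet> (H' *v e k)) / (1 + (l k)\<^sup>2))"
  proof -
    have "Im (\<i> * of_real a / (1 + \<i> * of_real b)) = a / (1 + b\<^sup>2)" for a b
      by (simp add: Im_divide power2_eq_square)
    thus ?thesis unfolding T_def B0 by (simp add: B'_def)
  qed
  \<comment> \<open>Rotated by \<open>- \<theta> t\<close>, the determinant stays on the positive real axis; comparing imaginary parts
    of the derivative gives the claim.\<close>
  define W where "W t = D t * cis (- \<theta> t)" for t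
  have dcis: "((\<lambda>t. cis (- \<theta> t)) has_vector_derivative (- \<theta>') *\<^sub>R (\<i> * cis (- \<theta> 0))) (at 0)"
  proof -
    have "((\<lambda>t. - \<theta> t) has_derivative (\<lambda>h. - \<theta>' * h)) (at 0)"
      using DERIV_minus[OF \<theta>'] by (simp only: has_field_derivative_def)
    from has_derivative_cis[OF this] show ?thesis
      by (simp add: has_vector_derivative_def mult.commute)
  qed
  have dW: "(W has_vector_derivative D 0 * ((- \<theta>') *\<^sub>R (\<i> * cis (- \<theta> 0))) + D' * cis (- \<theta> 0)) (at 0)"
    unfolding W_def by (rule has_vector_derivative_mult[OF dD dcis])
  obtain r where r: "0 < r" "D 0 = of_real r * cis (\<theta> 0)"
    using eventually_nhds_x_imp_x[OF polar] by blast
  have rot: "D 0 * cis (- \<theta> 0) = of_real r" unfolding r(2) by (simp add: mult.assoc cis_mult)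
  have "D 0 * ((- \<theta>') *\<^sub>R (\<i> * cis (- \<theta> 0))) + D' * cis (- \<theta> 0)
      = (D 0 * cis (- \<theta> 0)) * (T - \<i> * of_real \<theta>')"
    by (simp add: D'T algebra_simps scaleR_conv_of_real)
  also have "\<dots> = of_real r * (T - \<i> * of_real \<theta>')" unfolding rot ..
  finally have "(W has_vector_derivative of_real r * (T - \<i> * of_real \<theta>')) (at 0)" using dW by simp
  hence "((\<lambda>t. Im (W t)) has_real_derivative Im (of_real r * (T - \<i> * of_real \<theta>'))) (at 0)"
    unfolding has_real_derivative_iff_has_vector_derivative
    by (rule bounded_linear.has_vector_derivative[OF bounded_linear_Im])
  moreover have "\<forall>\<^sub>F t in nhds 0. Im (W t) = 0"
    using polar
  proof eventually_elim
    case (elim t)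
    then show ?case by (auto simp: W_def mult.assoc cis_mult)
  qed
  ultimately have "((\<lambda>t. 0) has_real_derivative Im (of_real r * (T - \<i> * of_real \<theta>'))) (at 0)"
    using DERIV_cong_ev[of 0 0 "\<lambda>t. Im (W t)" "\<lambda>t. 0"] by auto
  hence "Im (of_real r * (T - \<i> * of_real \<theta>')) = 0"
    using DERIV_const DERIV_unique by blast
  thus ?thesis using r(1) ImT by simp
qed

section \<open>Derivatives of functions of several variables\<close>

text \<open>The second difference of \<open>f\<close> over the parallelogram spanned by \<open>t a\<close> and \<open>t b\<close>
  does not distinguish the two directions; by the mean value theorem in one of them,
  followed by differentiability in the other, it is \<open>t\<^sup>2\<close> times a mixed derivative, up to \<open>o(t\<^sup>2)\<close>.\<close>
lemma second_difference_tendsto: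
  fixes f :: "'a::real_normed_vector \<Rightarrow> real"
  assumes S: "open S" "x \<in> S"
    and f': "\<And>y. y \<in> S \<Longrightarrow> (f has_derivative f' y) (at y)"
    and G: "((\<lambda>y. f' y a) has_derivative G) (at x)"
  shows "((\<lambda>t. (f (x + t *\<^sub>R a + t *\<^sub>R b) - f (x + t *\<^sub>R a) - f (x + t *\<^sub>R b) + f x) / t\<^sup>2)
     \<longlongrightarrow> G b) (at_right 0)"
proof (rule tendstoI)
  fix \<epsilon> :: real assume \<epsilon>: "0 < \<epsilon>"
  define c where "c = 2 * (norm a + norm b) + 1"
  define d where "d = \<epsilon> / (2 * c)"
  have c: "c > 0" unfolding c_def by (simp add: add_nonneg_pos)
  hence d: "d > 0" using \<epsilon> by (simp add: d_def)
  interpret G: bounded_linear G using G by (rule has_derivative_bounded_linear)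
  obtain \<delta>1 where \<delta>1: "\<delta>1 > 0" "\<And>y. norm (y - x) < \<delta>1 \<Longrightarrow>
      \<bar>f' y a - f' x a - G (y - x)\<bar> \<le> d * norm (y - x)"
    using G d unfolding has_derivative_at_alt real_norm_def by blast
  obtain \<delta>2 where \<delta>2: "\<delta>2 > 0" "ball x \<delta>2 \<subseteq> S" using S open_contains_ball by blast
  define \<delta> where "\<delta> = min \<delta>1 \<delta>2 / c"
  have "\<delta> > 0" using \<delta>1 \<delta>2 c by (simp add: \<delta>_def)
  moreover have "dist ((f (x + t *\<^sub>R a + t *\<^sub>R b) - f (x + t *\<^sub>R a) - f (x + t *\<^sub>R b) + f x) / t\<^sup>2) (G b) < \<epsilon>"
    if t: "0 < t" "t < \<delta>" for t
  proof -
    have tc: "t * c < min \<delta>1 \<delta>2" using t c by (simp add: \<delta>_def field_simps)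
    have small: "norm ((s * t) *\<^sub>R a + r *\<^sub>R b) \<le> t * (norm a + norm b)"
      if "0 \<le> s" "s \<le> 1" "0 \<le> r" "r \<le> t" for s r
    proof -
      have "norm ((s * t) *\<^sub>R a + r *\<^sub>R b) \<le> s * t * norm a + r * norm b"
        using norm_triangle_ineq[of "(s * t) *\<^sub>R a" "r *\<^sub>R b"] that t by simp
      also have "\<dots> \<le> t * norm a + t * norm b"
        using that t by (intro add_mono mult_right_mono) (auto simp: mult_left_le_one_le)
      finally show ?thesis by (simp add: algebra_simps)
    qed
    have tab: "t * (norm a + norm b) < min \<delta>1 \<delta>2"
    proof -
      have "t * (norm a + norm b) \<le> t * c"
        using t unfolding c_def by (intro mult_left_mono) (auto simp: add_nonneg_nonneg)
      thus ?thesis using tc by simp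
    qed
    have inS: "x + (s * t) *\<^sub>R a + r *\<^sub>R b \<in> S"
      if "0 \<le> s" "s \<le> 1" "0 \<le> r" "r \<le> t" for s r
    proof -
      have "dist (x + ((s * t) *\<^sub>R a + r *\<^sub>R b)) x < \<delta>2"
        using small[OF that] tab by (simp add: dist_norm)
      thus ?thesis using \<delta>2(2) by (auto simp: add.assoc dist_commute)
    qed
    define p where "p s = f (x + (s * t) *\<^sub>R a + t *\<^sub>R b) - f (x + (s * t) *\<^sub>R a)" for s
    have dp: "(p has_real_derivative t * (f' (x + (s * t) *\<^sub>R a + t *\<^sub>R b) a - f' (x + (s * t) *\<^sub>R a) a)) (at s)"
      if s: "0 \<le> s" "s \<le> 1" for s
    proof -
      have *: "((\<lambda>s. f (x + (s * t) *\<^sub>R a + r *\<^sub>R b)) has_real_derivative t * f' (x + (s * t) *\<^sub>R a + r *\<^sub>R b) a) (at s)"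
        if r: "0 \<le> r" "r \<le> t" for r
      proof -
        let ?y = "x + (s * t) *\<^sub>R a + r *\<^sub>R b"
        have "((\<lambda>s. x + (s * t) *\<^sub>R a + r *\<^sub>R b) has_derivative (\<lambda>h. (h * t) *\<^sub>R a)) (at s)"
          by (auto intro!: derivative_eq_intros)
        from has_derivative_compose[OF this f'[OF inS[OF s r]]]
        have "((\<lambda>s. f (x + (s * t) *\<^sub>R a + r *\<^sub>R b)) has_derivative (\<lambda>h. f' ?y ((h * t) *\<^sub>R a))) (at s)" .
        moreover interpret f': bounded_linear "f' ?y" using f'[OF inS[OF s r]] by (rule has_derivative_bounded_linear)
        have "(\<lambda>h. f' ?y ((h * t) *\<^sub>R a)) = (*) (t * f' ?y a)" by (auto simp: f'.scaleR)
        ultimately show ?thesis by (simp add: has_field_derivative_def)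
      qed
      show ?thesis unfolding p_def
        using DERIV_diff[OF *[of t] *[of 0]] t by (simp add: algebra_simps)
    qed
    obtain s where s: "0 < s" "s < 1"
      and ps: "p 1 - p 0 = t * (f' (x + (s * t) *\<^sub>R a + t *\<^sub>R b) a - f' (x + (s * t) *\<^sub>R a) a)"
      using MVT2[of 0 1 p, OF _ dp] by auto
    have est: "\<bar>f' (x + (s * t) *\<^sub>R a + r *\<^sub>R b) a - f' x a - G ((s * t) *\<^sub>R a + r *\<^sub>R b)\<bar> \<le> d * (t * (norm a + norm b))"
      if "0 \<le> r" "r \<le> t" for r
    proof -
      note sm = small[of s r, OF _ _ that]
      have "\<bar>f' (x + (s * t) *\<^sub>R a + r *\<^sub>R b) a - f' x a - G ((s * t) *\<^sub>R a + r *\<^sub>R b)\<bar> \<le> d * norm ((s * t) *\<^sub>R a + r *\<^sub>R b)"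
        using \<delta>1(2)[of "x + (s * t) *\<^sub>R a + r *\<^sub>R b"] sm s tab by (simp add: add.assoc)
      also have "\<dots> \<le> d * (t * (norm a + norm b))" using sm s d by (intro mult_left_mono) auto
      finally show ?thesis .
    qed
    have Gd: "G ((s * t) *\<^sub>R a + t *\<^sub>R b) - G ((s * t) *\<^sub>R a) = t * G b" by (simp add: G.add G.scaleR)
    have "\<bar>f' (x + (s * t) *\<^sub>R a + t *\<^sub>R b) a - f' (x + (s * t) *\<^sub>R a) a - t * G b\<bar> \<le> 2 * (d * (t * (norm a + norm b)))"
      using est[of t] est[of 0] t unfolding Gd[symmetric] by auto
    also have "\<dots> < t * \<epsilon>"
    proof -
      have "2 * (norm a + norm b) * d < c * d" using d by (intro mult_strict_right_mono) (auto simp: c_def)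
      also have "c * d \<le> \<epsilon>" using c \<epsilon> by (simp add: d_def)
      finally show ?thesis using t by (simp add: ac_simps)
    qed
    finally have *: "\<bar>f' (x + (s * t) *\<^sub>R a + t *\<^sub>R b) a - f' (x + (s * t) *\<^sub>R a) a - t * G b\<bar> < t * \<epsilon>"
      (is "\<bar>?X - _\<bar> < _") .
    have "\<bar>(p 1 - p 0) / t\<^sup>2 - G b\<bar> < \<epsilon>"
    proof -
      have "(p 1 - p 0) / t\<^sup>2 - G b = (?X - t * G b) / t"
        unfolding ps using t by (simp add: power2_eq_square field_simps)
      thus ?thesis using * t by (simp add: abs_divide divide_less_eq mult.commute)
    qed
    thus ?thesis by (simp add: p_def dist_real_def algebra_simps)
  qed
  ultimately show "\<forall>\<^sub>F t in at_right 0. dist ((f (x + t *\<^sub>R a + t *\<^sub>R b) - f (x + t *\<^sub>R a) - f (x + t *\<^sub>R b) + f x) / t\<^sup>2) (G b) < \<epsilon>"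
    unfolding eventually_at_right_field by blast
qed

lemma mixed_derivatives_symmetric:
  fixes f :: "'a::real_normed_vector \<Rightarrow> real"
  assumes S: "open S" "x \<in> S"
    and f': "\<And>y. y \<in> S \<Longrightarrow> (f has_derivative f' y) (at y)"
    and Ga: "((\<lambda>y. f' y a) has_derivative Ga) (at x)"
    and Gb: "((\<lambda>y. f' y b) has_derivative Gb) (at x)"
  shows "Ga b = Gb a"
proof -
  let ?\<Delta> = "\<lambda>t. (f (x + t *\<^sub>R a + t *\<^sub>R b) - f (x + t *\<^sub>R a) - f (x + t *\<^sub>R b) + f x) / t\<^sup>2"
  have "(?\<Delta> \<longlongrightarrow> Ga b) (at_right 0)" by (rule second_difference_tendsto[OF S f' Ga])
  moreover have "(?\<Delta> \<longlongrightarrow> Gb a) (at_right 0)"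
    using second_difference_tendsto[OF S f' Gb, of a] by (simp add: algebra_simps)
  ultimately show ?thesis using tendsto_unique trivial_limit_at_right_real by blast
qed

lemma has_derivative_along_line:
  fixes f :: "'a::real_normed_vector \<Rightarrow> real"
  assumes "(f has_derivative D) (at (x + t *\<^sub>R e))"
  shows "((\<lambda>t. f (x + t *\<^sub>R e)) has_real_derivative D e) (at t)"
proof -
  interpret D: bounded_linear D using assms by (rule has_derivative_bounded_linear)
  have "((\<lambda>t. x + t *\<^sub>R e) has_derivative (\<lambda>t. t *\<^sub>R e)) (at t)"
    by (auto intro!: derivative_eq_intros)
  from has_derivative_compose[OF this assms]
  have "((\<lambda>t. f (x + t *\<^sub>R e)) has_derivative (\<lambda>t. D (t *\<^sub>R e))) (at t)" .
  moreover have "(\<lambda>t. D (t *\<^sub>R e)) = (*) (D e)" by (auto simp: D.scaleR)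
  ultimately show ?thesis by (simp add: has_field_derivative_def)
qed

lemma local_max_second_derivative:
  fixes f :: "real \<Rightarrow> real"
  assumes r: "0 < r" and f': "\<And>t. \<bar>t\<bar> < r \<Longrightarrow> (f has_real_derivative f' t) (at t)"
    and f'': "(f' has_real_derivative d) (at 0)" and max: "\<And>t. \<bar>t\<bar> < r \<Longrightarrow> f t \<le> f 0"
  shows "f' 0 = 0" "d \<le> 0"
proof -
  show f'0: "f' 0 = 0"
    using DERIV_local_max[OF f'[of 0] r] r max by simp
  show "d \<le> 0"
  proof (rule ccontr)
    assume "\<not> d \<le> 0"
    then obtain \<delta> where \<delta>: "\<delta> > 0" "\<And>h. 0 < h \<Longrightarrow> h < \<delta> \<Longrightarrow> 0 < f' h"
      using DERIV_pos_inc_right[OF f''] f'0 by auto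
    define s where "s = min \<delta> r / 2"
    have s: "0 < s" "s < \<delta>" "s < r" using \<delta>(1) r by (auto simp: s_def)
    have "\<exists>z>0. z < s \<and> f s - f 0 = (s - 0) * f' z"
      by (rule MVT2[OF s(1)]) (use s in \<open>auto intro!: f'\<close>)
    then obtain z where "0 < z" "z < s" "f s - f 0 = s * f' z" by auto
    moreover have "0 < s * f' z" using \<delta>(2)[of z] calculation s by simp
    ultimately show False using max[of s] s by simp
  qed
qed

lemma iter_partial_simps [simp]:
  "iter_partial [] f = f"
  "iter_partial (i # is) f = partial_deriv i (iter_partial is f)"
  by (simp_all add: iter_partial_def)

lemma partial_deriv_eq:
  "(f has_derivative D) (at x) \<Longrightarrow> partial_deriv i f x = D (axis i 1)"
  unfolding partial_deriv_def by (metis frechet_derivative_at)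

lemma differentiable_has_gradient:
  fixes f :: "real^'n \<Rightarrow> real"
  assumes "f differentiable (at x)"
  shows "(f has_derivative (\<lambda>h. gradient f x \<bullet> h)) (at x)"
proof -
  obtain D where D: "(f has_derivative D) (at x)" using assms by (auto simp: differentiable_def)
  interpret D: bounded_linear D using D by (rule has_derivative_bounded_linear)
  have "D h = gradient f x \<bullet> h" for h
  proof -
    have "D h = D (\<Sum>i\<in>UNIV. h $ i *\<^sub>R axis i 1)"
      by (rule arg_cong[of _ _ D]) (simp add: basis_expansion flip: scalar_mult_eq_scaleR)
    also have "\<dots> = (\<Sum>i\<in>UNIV. h $ i * D (axis i 1))" by (simp add: D.sum D.scaleR)
    also have "\<dots> = gradient f x \<bullet> h"
      by (simp add: gradient_def inner_vec_def partial_deriv_eq[OF D] mult.commute)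
    finally show ?thesis .
  qed
  hence "D = (\<lambda>h. gradient f x \<bullet> h)" by blast
  thus ?thesis using D by simp
qed

definition hessian_deriv :: "(real^'n \<Rightarrow> real) \<Rightarrow> real^'n \<Rightarrow> real^'n \<Rightarrow> real^'n^'n" where
  "hessian_deriv f x h = (\<chi> i j. gradient (\<lambda>y. hessian f y $ i $ j) x \<bullet> h)"

context
  fixes u :: "real^'n \<Rightarrow> real" and S :: "(real^'n) set"
  assumes C3: "Ck_on 3 u S" and S: "open S"
begin

lemma C3_has_gradient: "x \<in> S \<Longrightarrow> (u has_derivative (\<lambda>h. gradient u x \<bullet> h)) (at x)"
  using C3 unfolding Ck_on_def
  by (intro differentiable_has_gradient) (metis iter_partial_simps(1) list.size(3) zero_less_numeral)

lemma C3_partial_has_derivative: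
  assumes "x \<in> S"
  shows "(partial_deriv j u has_derivative (\<lambda>h. \<Sum>i\<in>UNIV. h $ i * hessian u x $ i $ j)) (at x)"
proof -
  have "iter_partial [j] u differentiable (at x)"
    using C3 assms unfolding Ck_on_def by (metis One_nat_def length_Cons list.size(3) one_less_numeral_iff semiring_norm(77))
  hence "(partial_deriv j u has_derivative (\<lambda>h. gradient (partial_deriv j u) x \<bullet> h)) (at x)"
    by (intro differentiable_has_gradient) simp
  thus ?thesis by (simp add: gradient_def hessian_def inner_vec_def mult.commute)
qed

lemma C3_gradient_has_derivative:
  assumes "x \<in> S"
  shows "((\<lambda>y. gradient u y \<bullet> a) has_derivative (\<lambda>h. h \<bullet> (hessian u x *v a))) (at x)"
proof -
  have "((\<lambda>y. \<Sum>j\<in>UNIV. partial_deriv j u y * a $ j) has_derivative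
     (\<lambda>h. \<Sum>j\<in>UNIV. (\<Sum>i\<in>UNIV. h $ i * hessian u x $ i $ j) * a $ j)) (at x)"
    by (auto intro!: derivative_eq_intros C3_partial_has_derivative assms)
  moreover have "(\<Sum>j\<in>UNIV. (\<Sum>i\<in>UNIV. h $ i * hessian u x $ i $ j) * a $ j) = h \<bullet> (hessian u x *v a)" for h
    unfolding inner_vec_def matrix_vector_mult_def
    by (simp add: sum_distrib_left sum_distrib_right mult.assoc) (rule sum.swap)
  ultimately show ?thesis by (simp add: gradient_def inner_vec_def)
qed

lemma C3_hessian_entry_has_derivative:
  assumes "x \<in> S"
  shows "((\<lambda>y. hessian u y $ i $ j) has_derivative (\<lambda>h. hessian_deriv u x h $ i $ j)) (at x)"
proof -
  have "iter_partial [i, j] u differentiable (at x)"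
    using C3 assms unfolding Ck_on_def by (elim conjE allE[of _ "[i, j]"]) simp
  hence "(\<lambda>y. hessian u y $ i $ j) differentiable (at x)" by (simp add: hessian_def)
  thus ?thesis unfolding hessian_deriv_def by (simp add: differentiable_has_gradient)
qed

lemma C3_hessian_has_derivative:
  assumes "x \<in> S"
  shows "((\<lambda>y. a \<bullet> (hessian u y *v b)) has_derivative (\<lambda>h. a \<bullet> (hessian_deriv u x h *v b))) (at x)"
  unfolding inner_vec_def matrix_vector_mult_def
  by (auto intro!: derivative_eq_intros C3_hessian_entry_has_derivative assms)

lemma C3_hessian_symmetric:
  assumes "x \<in> S"
  shows "hessian u x $ i $ j = hessian u x $ j $ i"
proof -
  have "(\<lambda>y. gradient u y \<bullet> axis k 1) = partial_deriv k u" for k :: 'n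
    by (auto simp: gradient_def inner_axis)
  hence *: "((\<lambda>y. gradient u y \<bullet> axis k 1) has_derivative (\<lambda>h. \<Sum>i\<in>UNIV. h $ i * hessian u x $ i $ k)) (at x)" for k
    using C3_partial_has_derivative[OF assms, of k] by simp
  have "(\<Sum>k\<in>UNIV. axis j 1 $ k * hessian u x $ k $ i) = (\<Sum>k\<in>UNIV. axis i 1 $ k * hessian u x $ k $ j)"
    by (rule mixed_derivatives_symmetric[OF S assms C3_has_gradient * *])
  thus ?thesis by (simp add: axis_def if_distrib[of "\<lambda>z. z * _"] cong: if_cong)
qed

lemma C3_hessian_selfadjoint:
  assumes "x \<in> S"
  shows "a \<bullet> (hessian u x *v b) = b \<bullet> (hessian u x *v a)"
proof -
  have "transpose (hessian u x) = hessian u x"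
    by (simp add: vec_eq_iff transpose_def C3_hessian_symmetric[OF assms])
  thus ?thesis using dot_lmul_matrix[of a "hessian u x" b]
    by (metis inner_commute transpose_matrix_vector)
qed

text \<open>The left side is the second derivative of \<open>Du \<bullet> b\<close> along \<open>a\<close>, which occurs in the maximum
  principle; the right side is the second derivative of \<open>u\<close> along \<open>a\<close>, differentiated along
  \<open>b\<close>, which occurs in the linearized equation.\<close>
lemma C3_third_derivative_symmetric:
  assumes x: "x \<in> S"
  shows "a \<bullet> (hessian_deriv u x a *v b) = a \<bullet> (hessian_deriv u x b *v a)"
proof -
  have *: "((\<lambda>y. gradient u y \<bullet> a) has_derivative (\<lambda>h. h \<bullet> (hessian u y *v a))) (at y)" if "y \<in> S" for y
    using C3_gradient_has_derivative[OF that] .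
  have "b \<bullet> (hessian_deriv u x a *v a) = a \<bullet> (hessian_deriv u x b *v a)"
    using mixed_derivatives_symmetric[OF S x *  C3_hessian_has_derivative[OF x] C3_hessian_has_derivative[OF x]] .
  moreover have "a \<bullet> (hessian_deriv u x a *v b) = b \<bullet> (hessian_deriv u x a *v a)"
  proof -
    have "((\<lambda>y. a \<bullet> (hessian u y *v b)) has_derivative (\<lambda>h. b \<bullet> (hessian_deriv u x h *v a))) (at x)"
      by (rule has_derivative_transform_within_open[OF C3_hessian_has_derivative[OF x] S x])
         (rule C3_hessian_selfadjoint)
    from has_derivative_unique[OF C3_hessian_has_derivative[OF x] this] show ?thesis by meson
  qed
  ultimately show ?thesis by simp
qed

end

section \<open>Comparison with cones for infinity-superharmonic functions\<close>

text \<open>The test functions touching a cone are quadratic polynomials, which are \<open>C\<^sup>2\<close> everywhere;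
  the cone itself is not differentiable at its vertex.\<close>
definition quadratic :: "real \<Rightarrow> real^'n \<Rightarrow> real \<Rightarrow> real \<Rightarrow> real^'n \<Rightarrow> real^'n \<Rightarrow> real^'n \<Rightarrow> real" where
  "quadratic c b \<alpha> \<beta> e y x = c + b \<bullet> (x - y) + \<alpha> * ((x - y) \<bullet> (x - y)) + \<beta> * (e \<bullet> (x - y))\<^sup>2"

lemma quadratic_has_derivative:
  "(quadratic c b \<alpha> \<beta> e y has_derivative
     (\<lambda>h. b \<bullet> h + 2 * \<alpha> * ((x - y) \<bullet> h) + 2 * \<beta> * (e \<bullet> (x - y)) * (e \<bullet> h))) (at x)"
  unfolding quadratic_def [abs_def]
  by (auto intro!: derivative_eq_intros simp: power2_eq_square inner_commute algebra_simps fun_eq_iff)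

lemma quadratic_partial:
  "partial_deriv i (quadratic c b \<alpha> \<beta> e y) =
     (\<lambda>x. b $ i + 2 * \<alpha> * (x $ i - y $ i) + 2 * \<beta> * (e \<bullet> (x - y)) * e $ i)"
  by (rule ext, subst partial_deriv_eq[OF quadratic_has_derivative]) (simp add: inner_axis)

lemma quadratic_partial_has_derivative:
  "((\<lambda>x. b $ i + 2 * \<alpha> * (x $ i - y $ i) + 2 * \<beta> * (e \<bullet> (x - y)) * e $ i) has_derivative
    (\<lambda>h. 2 * \<alpha> * h $ i + 2 * \<beta> * (e \<bullet> h) * e $ i)) (at x)"
  by (auto intro!: derivative_eq_intros bounded_linear.has_derivative[OF bounded_linear_vec_nth] simp: algebra_simps)

lemma quadratic_partial2:
  "partial_deriv j (partial_deriv i (quadratic c b \<alpha> \<beta> e y)) =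
     (\<lambda>x. (if i = j then 2 * \<alpha> else 0) + 2 * \<beta> * e $ j * e $ i)"
  unfolding quadratic_partial
  by (rule ext, subst partial_deriv_eq[OF quadratic_partial_has_derivative]) (simp add: inner_axis, simp add: axis_def)

lemma Ck_on_quadratic: "Ck_on 2 (quadratic c b \<alpha> \<beta> e y) S"
proof -
  have diff: "iter_partial is (quadratic c b \<alpha> \<beta> e y) differentiable (at x)" if "length is < 2" for x "is"
  proof (cases "is")
    case Nil
    then show ?thesis using quadratic_has_derivative differentiable_def by force
  next
    case (Cons i js)
    hence "is = [i]" using that by (cases js) auto
    then show ?thesis
      using quadratic_partial_has_derivative differentiable_def by (force simp: quadratic_partial)
  qed
  moreover have "continuous_on S (iter_partial is (quadratic c b \<alpha> \<beta> e y))" if l: "length is \<le> 2" for "is"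
  proof (cases "length is < 2")
    case True
    have "continuous (at x) (iter_partial is (quadratic c b \<alpha> \<beta> e y))" for x
      using diff[OF True] by (rule differentiable_imp_continuous_within)
    thus ?thesis using continuous_at_imp_continuous_on by blast
  next
    case False
    hence "length is = Suc (Suc 0)" using l by simp
    then obtain i j where "is = [i, j]" by (auto simp: length_Suc_conv)
    thus ?thesis by (simp add: quadratic_partial2)
  qed
  ultimately show ?thesis unfolding Ck_on_def by blast
qed

lemma quadratic_infinity_laplacian:
  fixes x y b e :: "real^'n" and c \<alpha> \<beta> :: real
  defines "g \<equiv> b + (2 * \<alpha>) *\<^sub>R (x - y) + (2 * \<beta> * (e \<bullet> (x - y))) *\<^sub>R e"
  shows "(\<Sum>i\<in>UNIV. \<Sum>j\<in>UNIV. hessian (quadratic c b \<alpha> \<beta> e y) x $ i $ j *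
       gradient (quadratic c b \<alpha> \<beta> e y) x $ i * gradient (quadratic c b \<alpha> \<beta> e y) x $ j)
     = 2 * \<alpha> * (g \<bullet> g) + 2 * \<beta> * (e \<bullet> g)\<^sup>2"
proof -
  have grad: "gradient (quadratic c b \<alpha> \<beta> e y) x $ i = g $ i" for i
    by (simp add: gradient_def quadratic_partial g_def)
  have hess: "hessian (quadratic c b \<alpha> \<beta> e y) x $ i $ j = (if i = j then 2 * \<alpha> else 0) + 2 * \<beta> * e $ i * e $ j" for i j
    by (simp add: hessian_def quadratic_partial2)
  have "(\<Sum>i\<in>UNIV. \<Sum>j\<in>UNIV. ((if i = j then 2 * \<alpha> else 0) + 2 * \<beta> * e $ i * e $ j) * g $ i * g $ j)
     = (\<Sum>i\<in>UNIV. \<Sum>j\<in>UNIV. (if i = j then 2 * \<alpha> * g $ i * g $ j else 0)) +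
       (\<Sum>i\<in>UNIV. \<Sum>j\<in>UNIV. 2 * \<beta> * (e $ i * g $ i) * (e $ j * g $ j))"
    unfolding sum.distrib[symmetric] by (intro sum.cong refl) (auto simp: algebra_simps)
  also have "(\<Sum>i\<in>UNIV. \<Sum>j\<in>UNIV. (if i = j then 2 * \<alpha> * g $ i * g $ j else 0)) = 2 * \<alpha> * (g \<bullet> g)"
    by (simp add: inner_vec_def sum_distrib_left mult.assoc)
  also have "(\<Sum>i\<in>UNIV. \<Sum>j\<in>UNIV. 2 * \<beta> * (e $ i * g $ i) * (e $ j * g $ j)) = 2 * \<beta> * (e \<bullet> g)\<^sup>2"
    unfolding inner_vec_def inner_real_def power2_eq_square sum_product
    by (simp add: sum_distrib_left mult.assoc)
  finally show ?thesis unfolding grad hess .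
qed

text \<open>Near the point \<open>R e\<close> the paraboloid on the right lies above the cone \<open>norm\<close>, touches it there
  and, like the cone, is linear along the ray through \<open>e\<close>.\<close>
lemma norm_le_paraboloid:
  fixes d e :: "'a::real_inner"
  assumes "norm e = 1" "0 < R" "R / 2 \<le> e \<bullet> d"
  shows "norm d \<le> e \<bullet> d + (d \<bullet> d - (e \<bullet> d)\<^sup>2) / R"
proof -
  define t where "t = e \<bullet> d"
  define q where "q = d \<bullet> d - t\<^sup>2"
  have "\<bar>t\<bar> \<le> norm d" using Cauchy_Schwarz_ineq2[of e d] assms(1) by (simp add: t_def)
  hence q: "0 \<le> q" unfolding q_def
    by (metis abs_ge_zero diff_ge_0_iff_ge power2_abs power2_norm_eq_inner power_mono)
  have t: "0 < t" "R \<le> 2 * t" using assms by (auto simp: t_def)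
  have "q \<le> 2 * t * (q / R)" using mult_right_mono[OF t(2) q] assms(2) by (simp add: field_simps)
  moreover have "(t + q / R)\<^sup>2 = t\<^sup>2 + (q / R)\<^sup>2 + 2 * t * (q / R)" by (rule power2_sum)
  moreover have "0 \<le> (q / R)\<^sup>2" by (rule zero_le_power2)
  moreover have "(norm d)\<^sup>2 = q + t\<^sup>2" by (simp add: q_def power2_norm_eq_inner)
  ultimately have "(norm d)\<^sup>2 \<le> (t + q / R)\<^sup>2" by linarith
  moreover have "0 \<le> t + q / R" using t(1) q assms(2) by (simp add: add_nonneg_nonneg)
  ultimately have "norm d \<le> t + q / R" by (rule power2_le_imp_le)
  thus ?thesis by (simp add: q_def t_def)
qed

text \<open>The added \<open>\<epsilon> |x - y|\<^sup>2\<close> makes the cone convex in the radial direction, which for a radial function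
  determines the sign of the infinity Laplacian.  Hence \<open>\<phi>\<close> minus the cone has no interior minimum
  except at the vertex, where the two agree.  The slope is chosen so that the cone is
  negative on the sphere of radius \<open>r\<close>, and so that its radial derivative does not vanish
  inside it.\<close>
lemma infinity_supersolution_strict_cone:
  fixes \<phi> :: "real^'n \<Rightarrow> real"
  assumes sup: "infinity_supersolution \<phi> S" and S: "open S" "cball y r \<subseteq> S" and r: "0 < r"
    and nonneg: "\<And>x. x \<in> cball y r \<Longrightarrow> 0 \<le> \<phi> x" and \<epsilon>: "0 < \<epsilon>" and x: "x \<in> cball y r"
  shows "\<phi> y - (\<phi> y / r + 2 * \<epsilon> * r) * norm (x - y) + \<epsilon> * (norm (x - y))\<^sup>2 \<le> \<phi> x"
proof -
  define a where "a = \<phi> y / r + 2 * \<epsilon> * r"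
  define C where "C x = \<phi> y - a * norm (x - y) + \<epsilon> * (norm (x - y))\<^sup>2" for x
  have \<phi>y: "0 \<le> \<phi> y" using nonneg r by simp
  hence a: "2 * \<epsilon> * r \<le> a" using r by (simp add: a_def)
  have cont: "continuous_on (cball y r) (\<lambda>x. \<phi> x - C x)"
    unfolding C_def using sup S(2)
    by (auto intro!: continuous_intros simp: infinity_supersolution_def intro: continuous_on_subset)
  obtain z where z: "z \<in> cball y r" and min: "\<And>x. x \<in> cball y r \<Longrightarrow> \<phi> z - C z \<le> \<phi> x - C x"
    using continuous_attains_inf[OF compact_cball _ cont] r by (metis centre_in_cball empty_iff less_imp_le)
  have "0 \<le> \<phi> z - C z"
  proof (rule ccontr)
    assume "\<not> 0 \<le> \<phi> z - C z"
    hence neg: "\<phi> z < C z" by simp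
    define R where "R = norm (z - y)"
    have R0: "R \<noteq> 0" using neg by (auto simp: R_def C_def)
    have "R \<noteq> r"
    proof
      assume "R = r"
      hence "C z = - (\<epsilon> * r\<^sup>2)" using r by (simp add: C_def a_def R_def[symmetric] field_simps power2_eq_square)
      moreover have "0 \<le> \<epsilon> * r\<^sup>2" using \<epsilon> by simp
      ultimately show False using neg nonneg[OF z] by simp
    qed
    hence R: "0 < R" "R < r" using z R0 by (auto simp: R_def dist_norm norm_minus_commute less_le)
    define e where "e = (z - y) /\<^sub>R R"
    have e: "norm e = 1" using R by (simp add: e_def R_def)
    have zy: "z - y = R *\<^sub>R e" using R by (simp add: e_def)
    have ee: "e \<bullet> e = 1" using e by (simp add: norm_eq_1)
    \<comment> \<open>The quadratic polynomial touches the cone from below at \<open>z\<close> and has the same second derivative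
      in the radial direction.\<close>
    define P where "P = quadratic (\<phi> y) (- a *\<^sub>R e) (- (a / R)) (a / R + \<epsilon>) e y"
    have Pz: "P z = C z"
      using R by (simp add: P_def quadratic_def C_def zy e ee power2_eq_square field_simps)
    have P_le: "P x \<le> C x" if x: "x \<in> ball z (R / 2)" for x
    proof -
      let ?d = "x - y"
      have split: "e \<bullet> ?d = R + e \<bullet> (x - z)"
        using zy ee by (simp add: inner_diff_right algebra_simps)
      have "\<bar>e \<bullet> (x - z)\<bar> \<le> norm (x - z)" using Cauchy_Schwarz_ineq2[of e "x - z"] e by simp
      also have "\<dots> < R / 2" using x by (simp add: dist_norm norm_minus_commute)
      finally have t: "R / 2 \<le> e \<bullet> ?d" unfolding split by linarith
      have "a * norm ?d \<le> a * (e \<bullet> ?d + (?d \<bullet> ?d - (e \<bullet> ?d)\<^sup>2) / R)"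
        using norm_le_paraboloid[OF e R(1) t] a \<epsilon> r by (intro mult_left_mono) (auto intro: order_trans[rotated])
      moreover have "\<epsilon> * (e \<bullet> ?d)\<^sup>2 \<le> \<epsilon> * (norm ?d)\<^sup>2"
      proof -
        have "\<bar>e \<bullet> ?d\<bar> \<le> norm ?d" using Cauchy_Schwarz_ineq2[of e ?d] e by simp
        hence "(e \<bullet> ?d)\<^sup>2 \<le> (norm ?d)\<^sup>2" by (metis abs_ge_zero power2_abs power_mono)
        thus ?thesis using \<epsilon> by simp
      qed
      moreover have "P x = \<phi> y - a * (e \<bullet> ?d + (?d \<bullet> ?d - (e \<bullet> ?d)\<^sup>2) / R) + \<epsilon> * (e \<bullet> ?d)\<^sup>2"
        by (simp add: P_def quadratic_def algebra_simps add_divide_distrib diff_divide_distrib)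
      ultimately show ?thesis by (simp add: C_def)
    qed
    have "z \<in> S" using z S by blast
    moreover have "\<exists>\<rho>>0. Ck_on 2 P (ball z \<rho>)" unfolding P_def by (intro exI[of _ 1]) (simp add: Ck_on_quadratic)
    moreover have "\<exists>\<rho>>0. \<forall>x\<in>S \<inter> ball z \<rho>. \<phi> z - P z \<le> \<phi> x - P x"
    proof (intro exI[of _ "min (R / 2) (r - R)"] conjI ballI)
      show "0 < min (R / 2) (r - R)" using R by simp
      fix x assume x: "x \<in> S \<inter> ball z (min (R / 2) (r - R))"
      have "dist y x \<le> dist y z + dist z x" by (rule dist_triangle)
      also have "dist y z = R" by (simp add: R_def dist_norm norm_minus_commute)
      finally have "x \<in> cball y r" using x by simp
      from min[OF this] P_le[of x] x Pz show "\<phi> z - P z \<le> \<phi> x - P x" by simp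
    qed
    ultimately have "(\<Sum>i\<in>UNIV. \<Sum>j\<in>UNIV. hessian P z $ i $ j * gradient P z $ i * gradient P z $ j) \<le> 0"
      using sup unfolding infinity_supersolution_def by blast
    moreover have "- a *\<^sub>R e + (2 * - (a / R)) *\<^sub>R (z - y) + (2 * (a / R + \<epsilon>) * (e \<bullet> (z - y))) *\<^sub>R e = (2 * \<epsilon> * R - a) *\<^sub>R e"
    proof -
      have coeff: "2 * \<epsilon> * R - a = - a + 2 * - (a / R) * R + 2 * (a / R + \<epsilon>) * R"
        using R by (simp add: field_simps)
      show ?thesis
        unfolding coeff zy by (simp only: scaleR_left_distrib scaleR_scaleR inner_scaleR_right ee mult_1_right)
    qed
    ultimately have "2 * - (a / R) * (2 * \<epsilon> * R - a)\<^sup>2 + 2 * (a / R + \<epsilon>) * (2 * \<epsilon> * R - a)\<^sup>2 \<le> 0"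
      unfolding P_def quadratic_infinity_laplacian by (simp add: ee power2_eq_square)
    hence "2 * \<epsilon> * (2 * \<epsilon> * R - a)\<^sup>2 \<le> 0" by (simp add: algebra_simps)
    moreover have "2 * \<epsilon> * R < 2 * \<epsilon> * r" using \<epsilon> R by simp
    hence "2 * \<epsilon> * R - a \<noteq> 0" using a by linarith
    ultimately show False using \<epsilon> by (simp add: mult_le_0_iff)
  qed
  with min[OF x] show ?thesis by (simp add: C_def a_def)
qed

lemma infinity_supersolution_cone_comparison:
  fixes \<phi> :: "real^'n \<Rightarrow> real"
  assumes sup: "infinity_supersolution \<phi> S" and S: "open S" "cball y r \<subseteq> S" and r: "0 < r"
    and nonneg: "\<And>x. x \<in> cball y r \<Longrightarrow> 0 \<le> \<phi> x" and x: "x \<in> cball y r"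
  shows "\<phi> y - \<phi> y / r * norm (x - y) \<le> \<phi> x"
proof -
  let ?f = "\<lambda>\<epsilon>. \<phi> y - (\<phi> y / r + 2 * \<epsilon> * r) * norm (x - y) + \<epsilon> * (norm (x - y))\<^sup>2"
  have "(?f \<longlongrightarrow> ?f 0) (at_right 0)" by (intro tendsto_intros)
  moreover have "\<forall>\<^sub>F \<epsilon> in at_right 0. ?f \<epsilon> \<le> \<phi> x"
    using eventually_at_right_less
    by eventually_elim (rule infinity_supersolution_strict_cone[OF sup S r nonneg _ x])
  ultimately have "?f 0 \<le> \<phi> x" by (rule tendsto_upperbound) simp
  thus ?thesis by simp
qed

text \<open>The Harnack-type bound \<open>|D\<phi>(y)| \<le> \<phi>(y) / r\<close>: this is what makes the derivative of the phase
  negligible where the phase is nearly critical.\<close>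
lemma infinity_supersolution_gradient:
  fixes \<phi> :: "real^'n \<Rightarrow> real"
  assumes sup: "infinity_supersolution \<phi> S" and S: "open S" "cball y r \<subseteq> S" and r: "0 < r"
    and nonneg: "\<And>x. x \<in> cball y r \<Longrightarrow> 0 \<le> \<phi> x" and D: "(\<phi> has_derivative D) (at y)"
    and h: "norm h = 1"
  shows "- (\<phi> y / r) \<le> D h"
proof (rule ccontr)
  assume "\<not> - (\<phi> y / r) \<le> D h"
  hence neg: "D h + \<phi> y / r < 0" by simp
  have "((\<lambda>t. \<phi> (y + t *\<^sub>R h)) has_real_derivative D h) (at 0)"
    by (rule has_derivative_along_line) (use D in simp)
  hence "((\<lambda>t. \<phi> (y + t *\<^sub>R h) + \<phi> y / r * t) has_real_derivative D h + \<phi> y / r) (at 0)"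
    using r by (auto intro!: derivative_eq_intros)
  from DERIV_neg_dec_right[OF this neg] obtain d where d: "d > 0"
    "\<And>t. 0 < t \<Longrightarrow> t < d \<Longrightarrow> \<phi> (y + t *\<^sub>R h) + \<phi> y / r * t < \<phi> y" by auto
  define t where "t = min (d / 2) r"
  have t: "0 < t" "t < d" "t \<le> r" using d(1) r by (auto simp: t_def)
  have "y + t *\<^sub>R h \<in> cball y r" using t h by (simp add: dist_norm)
  from infinity_supersolution_cone_comparison[OF sup S r nonneg this] d(2)[OF t(1,2)] t h
  show False by simp
qed

section \<open>The inequality at a maximum point\<close>

lemma sum_arctan_le:
  "finite K \<Longrightarrow> (\<Sum>k\<in>K. arctan (l k)) \<le> real (card K) * (pi / 2)"
  using sum_bounded_above[of K "\<lambda>k. arctan (l k)" "pi / 2"] arctan_ubound by (simp add: less_imp_le)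

lemma arctan_le_self: "0 \<le> x \<Longrightarrow> arctan x \<le> (x::real)"
proof (rule DERIV_nonneg_imp_nondecreasing[of 0 x "\<lambda>x. x - arctan x", simplified])
  fix y :: real
  have "((\<lambda>x. x - arctan x) has_real_derivative 1 - inverse (1 + y\<^sup>2)) (at y)"
    by (auto intro!: derivative_eq_intros)
  moreover have "0 \<le> 1 - inverse (1 + y\<^sup>2)" by (simp add: inverse_le_1_iff)
  ultimately show "\<exists>d. ((\<lambda>x. x - arctan x) has_real_derivative d) (at y) \<and> 0 \<le> d" by blast
qed

text \<open>Every term of the phase is below \<open>\<pi>/2\<close>, so a phase of at least \<open>(n - 2) \<pi>/2\<close> leaves room for one
  negative eigenvalue only.  If it is very negative, then all other eigenvalues are large
  and the phase is nearly critical.\<close>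
lemma negative_eigenvalue_phase:
  fixes l :: "'n::finite \<Rightarrow> real"
  assumes phase: "(\<Sum>k\<in>UNIV. arctan (l k)) = (real CARD('n) - 2) * (pi / 2) + \<phi>"
    and \<phi>: "0 \<le> \<phi>" and neg: "l k < 0"
  shows "\<phi> \<le> 1 / (- l k)" and "j \<noteq> k \<Longrightarrow> - l k \<le> l j"
proof -
  have card: "real (card (UNIV - {k})) = real CARD('n) - 1"
    by (simp add: of_nat_diff)
  have "(\<Sum>k\<in>UNIV. arctan (l k)) = arctan (l k) + (\<Sum>k\<in>UNIV - {k}. arctan (l k))"
    by (rule sum.remove) auto
  also have "\<dots> \<le> arctan (l k) + (real CARD('n) - 1) * (pi / 2)"
    using sum_arctan_le[of "UNIV - {k}" l] unfolding card by simp
  finally have "\<phi> \<le> arctan (l k) + pi / 2" unfolding phase by (simp add: left_diff_distrib diff_divide_distrib)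
  also have "\<dots> = arctan (1 / (- l k))"
    using arctan_inverse[of "- l k"] neg by (simp add: arctan_minus inverse_eq_divide)
  also have "\<dots> \<le> 1 / (- l k)" using neg by (intro arctan_le_self) (simp add: divide_nonneg_neg)
  finally show "\<phi> \<le> 1 / (- l k)" .
  show "- l k \<le> l j" if jk: "j \<noteq> k"
  proof -
    have "card (UNIV - {k} - {j}) + 2 = CARD('n)"
      using jk card_Diff_singleton[of j "UNIV - {k}"] card_Diff_singleton[of k UNIV]
        card_mono[of UNIV "{j, k}"] by auto
    hence card2: "real (card (UNIV - {k} - {j})) = real CARD('n) - 2" by linarith
    have "(\<Sum>k\<in>UNIV. arctan (l k)) = arctan (l k) + (arctan (l j) + (\<Sum>k\<in>UNIV - {k} - {j}. arctan (l k)))"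
      using jk by (subst sum.remove[of UNIV k], simp_all) (subst sum.remove[of "UNIV - {k}" j], simp_all)
    also have "\<dots> \<le> arctan (l k) + (arctan (l j) + (real CARD('n) - 2) * (pi / 2))"
      using sum_arctan_le[of "UNIV - {k} - {j}" l] unfolding card2 by simp
    finally have "arctan (- l k) \<le> arctan (l j)" unfolding phase using \<phi> by (simp add: arctan_minus)
    thus ?thesis by (simp add: arctan_le_iff)
  qed
qed

text \<open>The algebra at an interior maximum, in a basis of eigenvectors: \<open>l\<close> are the eigenvalues of the
  Hessian of \<open>u\<close>, \<open>\<nu>\<close> the components of \<open>Du / |Du|\<close>, \<open>d\<close> those of \<open>D\<eta>\<close>, \<open>T\<close> the
  third derivatives of \<open>u\<close>, \<open>P = |Du|\<close>, and \<open>D\<close> the derivative of the phase along \<open>\<nu>\<close>.  Some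
  component satisfies \<open>\<nu>\<^sub>k\<^sup>2 \<ge> 1/n\<close>, and there the first-order condition gives
  \<open>l\<^sub>k = -m\<close> with \<open>m\<close> between \<open>n P/\<eta>\<close> and \<open>5 n P/\<eta>\<close>.  Thus \<open>1/(1 + m\<^sup>2)\<close> is the largest
  coefficient of the linearized operator, and \<open>D \<ge> -4/m\<close>.  Summing the second-order
  conditions against the coefficients, the term \<open>2 P\<^sup>2/M\<close> coming from \<open>u\<^sup>2\<close> dominates the errors
  of order \<open>P/\<eta>\<close> once \<open>\<eta> P\<close> exceeds a multiple of \<open>M\<close>.\<close>
lemma critical_point_estimate:
  fixes l \<nu> d T :: "'n::finite \<Rightarrow> real" and P M U \<eta> \<phi> D :: real
  defines "N \<equiv> real CARD('n)"
  assumes \<eta>: "0 < \<eta>" "\<eta> \<le> 1 / 4" and P: "0 < P" and M: "1 \<le> M" and U: "M \<le> U" "U \<le> 2 * M"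
    and \<nu>: "(\<Sum>k\<in>UNIV. (\<nu> k)\<^sup>2) = 1" and d: "\<And>k. \<bar>d k\<bar> \<le> 1"
    and first: "\<And>k. \<eta> * (l k * \<nu> k) + d k * P + 2 * (N / M) * U * (P * \<nu> k) = 0"
    and second: "\<And>k. \<eta> * T k + 2 * d k * (l k * \<nu> k) - 2 * P
        + 2 * (N / M) * (P * \<nu> k)\<^sup>2 + 2 * (N / M) * U * l k \<le> 0"
    and trace: "(\<Sum>k\<in>UNIV. T k / (1 + (l k)\<^sup>2)) = D" and D: "- (4 * \<phi>) \<le> D"
    and phase: "(\<Sum>k\<in>UNIV. arctan (l k)) = (N - 2) * (pi / 2) + \<phi>" and \<phi>: "0 \<le> \<phi>"
  shows "\<eta> * P \<le> 32 * N\<^sup>2 * M"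
proof (rule ccontr)
  assume "\<not> ?thesis"
  hence big: "32 * N\<^sup>2 * M < \<eta> * P" by simp
  have N: "1 \<le> N" by (simp add: N_def Suc_le_eq)
  hence NN: "N \<le> N\<^sup>2" "1 \<le> N\<^sup>2" by (simp_all add: power2_eq_square mult_ge1_I)
  define B where "B = N / M * U"
  have B: "N \<le> B" "B \<le> 2 * N" using U M N by (simp_all add: B_def field_simps)
  define Q where "Q = P / \<eta>"
  have Q: "P = \<eta> * Q" "0 < Q" using \<eta> P by (simp_all add: Q_def)
  have PQ: "P \<le> Q" using Q \<eta> by simp
  have first': "l k * \<nu> k = - Q * (d k + 2 * B * \<nu> k)" for k
  proof -
    have "\<eta> * (l k * \<nu> k) = \<eta> * (- Q * (d k + 2 * B * \<nu> k))"
      using first[of k] unfolding Q(1) B_def by (simp add: algebra_simps)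
    thus ?thesis using \<eta>(1) by (metis less_irrefl mult_left_cancel)
  qed
  obtain k where "1 / N \<le> (\<nu> k)\<^sup>2"
  proof -
    have "\<exists>k. 1 / N \<le> (\<nu> k)\<^sup>2"
    proof (rule ccontr)
      assume "\<not> ?thesis"
      hence "(\<Sum>k\<in>UNIV. (\<nu> k)\<^sup>2) < (\<Sum>k\<in>(UNIV::'n set). 1 / N)" by (intro sum_strict_mono) (auto simp: not_le)
      thus False using \<nu> N by (simp add: N_def)
    qed
    thus ?thesis using that by blast
  qed
  hence \<nu>k: "1 \<le> N * (\<nu> k)\<^sup>2" using N by (simp add: field_simps)
  hence \<nu>0: "\<nu> k \<noteq> 0" by auto
  have "\<bar>d k / \<nu> k\<bar> \<le> N"
  proof -
    have "1 \<le> N * (N * (\<nu> k)\<^sup>2)" using \<nu>k N by (simp add: mult_ge1_I)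
    hence "1 \<le> (N * \<bar>\<nu> k\<bar>)\<^sup>2" by (simp add: power2_eq_square algebra_simps)
    hence "1 \<le> N * \<bar>\<nu> k\<bar>" using N by (metis abs_ge_zero mult_nonneg_nonneg one_power2 order_trans power2_le_imp_le zero_le_one)
    hence "\<bar>d k\<bar> \<le> N * \<bar>\<nu> k\<bar>" using d[of k] by simp
    thus ?thesis using \<nu>0 by (simp add: abs_divide field_simps)
  qed
  hence dk: "- N \<le> d k / \<nu> k" "d k / \<nu> k \<le> N" unfolding abs_le_iff by linarith+
  define m where "m = - l k"
  have mk: "m = Q * (2 * B + d k / \<nu> k)"
    using first'[of k] \<nu>0 by (simp add: m_def field_simps)
  have m_lower: "Q * N \<le> m" unfolding mk using B dk Q by (intro mult_left_mono) auto
  have m_upper: "m \<le> Q * (5 * N)" unfolding mk using B dk Q by (intro mult_left_mono) auto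
  have P_big: "128 * N\<^sup>2 * M < P"
  proof -
    have "\<eta> * P \<le> 1 / 4 * P" using \<eta> P by (intro mult_right_mono) auto
    thus ?thesis using big by simp
  qed
  have NM: "1 \<le> N\<^sup>2 * M" using NN M by (simp add: mult_ge1_I)
  have "1 \<le> Q" using P_big NM PQ by linarith
  hence m1: "1 \<le> m" using m_lower N mult_ge1_I[of Q N] by linarith
  hence neg: "l k < 0" by (simp add: m_def)
  have \<phi>m: "\<phi> \<le> 1 / m"
    using negative_eigenvalue_phase(1)[OF phase[unfolded N_def] \<phi> neg] by (simp add: m_def)
  have lj: "m \<le> l j" if "j \<noteq> k" for j
    using negative_eigenvalue_phase(2)[OF phase[unfolded N_def] \<phi> neg that] by (simp add: m_def)
  define g where "g = 1 / (1 + m\<^sup>2)"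
  have g: "0 < g" by (simp add: g_def add_pos_nonneg)
  have gj: "0 < 1 / (1 + (l j)\<^sup>2)" "1 / (1 + (l j)\<^sup>2) \<le> g" for j
  proof -
    show "0 < 1 / (1 + (l j)\<^sup>2)" by (simp add: add_pos_nonneg)
    have "m\<^sup>2 \<le> (l j)\<^sup>2"
    proof (cases "j = k")
      case False
      thus ?thesis using lj m1 by (intro power_mono) auto
    qed (simp add: m_def)
    thus "1 / (1 + (l j)\<^sup>2) \<le> g" unfolding g_def by (intro divide_left_mono) (auto simp: add_pos_nonneg)
  qed
  define X where "X j = 2 * d j * (l j * \<nu> j) - 2 * P + 2 * (N / M) * (P * \<nu> j)\<^sup>2 + 2 * B * l j" for j
  have cross: "- (10 * N * Q) \<le> 2 * d j * (l j * \<nu> j)" for j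
  proof -
    have "(\<nu> j)\<^sup>2 \<le> 1" using \<nu> member_le_sum[of j UNIV "\<lambda>k. (\<nu> k)\<^sup>2"] by simp
    hence \<nu>1: "\<bar>\<nu> j\<bar> \<le> 1" by (simp add: abs_square_le_1)
    have "\<bar>d j + 2 * B * \<nu> j\<bar> \<le> \<bar>d j\<bar> + 2 * B * \<bar>\<nu> j\<bar>"
      using B N abs_triangle_ineq[of "d j" "2 * B * \<nu> j"] by (simp add: abs_mult)
    also have "\<dots> \<le> 1 + 2 * B * 1" using d[of j] \<nu>1 B N by (intro add_mono mult_left_mono) auto
    also have "\<dots> \<le> 5 * N" using B N by linarith
    finally have "\<bar>d j + 2 * B * \<nu> j\<bar> \<le> 5 * N" .
    hence "\<bar>d j\<bar> * \<bar>d j + 2 * B * \<nu> j\<bar> \<le> 1 * (5 * N)" using d[of j] by (intro mult_mono) auto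
    hence "\<bar>d j * (d j + 2 * B * \<nu> j)\<bar> \<le> 5 * N" by (simp add: abs_mult)
    hence "2 * Q * (d j * (d j + 2 * B * \<nu> j)) \<le> 2 * Q * (5 * N)"
      using Q(2) by (intro mult_left_mono) auto
    also have "\<dots> = 10 * N * Q" by simp
    finally have "2 * Q * (d j * (d j + 2 * B * \<nu> j)) \<le> 10 * N * Q" .
    moreover have "2 * d j * (l j * \<nu> j) = - (2 * Q * (d j * (d j + 2 * B * \<nu> j)))"
      unfolding first' by (simp add: algebra_simps)
    ultimately show ?thesis by linarith
  qed
  have "P \<le> N * Q" using PQ N Q mult_right_mono[of 1 N Q] by simp
  hence base: "- (12 * N * Q) \<le> 2 * d j * (l j * \<nu> j) - 2 * P" for j using cross[of j] by linarith
  have sq: "0 \<le> 2 * (N / M) * (P * \<nu> j)\<^sup>2" for j using N M by simp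
  have Xj: "- (12 * N * Q) \<le> X j" if "j \<noteq> k" for j
  proof -
    have "0 \<le> l j" using lj[OF that] m1 by linarith
    hence "0 \<le> 2 * B * l j" using B N by simp
    thus ?thesis using base[of j] sq[of j] unfolding X_def by linarith
  qed
  have Xk: "2 * P\<^sup>2 / M - 12 * N * Q - 20 * N\<^sup>2 * Q \<le> X k"
  proof -
    have "2 * (P\<^sup>2 / M) * 1 \<le> 2 * (P\<^sup>2 / M) * (N * (\<nu> k)\<^sup>2)" using \<nu>k M by (intro mult_left_mono) auto
    hence "2 * P\<^sup>2 / M \<le> 2 * (N / M) * (P * \<nu> k)\<^sup>2" by (simp add: power_mult_distrib mult_ac)
    moreover have "2 * B * m \<le> (2 * (2 * N)) * (Q * (5 * N))" using B N m_upper m1 by (intro mult_mono) auto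
    hence "- (20 * N\<^sup>2 * Q) \<le> 2 * B * l k" by (simp add: m_def power2_eq_square mult_ac)
    ultimately show ?thesis using base[of k] unfolding X_def by linarith
  qed
  have each: "(if j = k then g * (2 * P\<^sup>2 / M - 20 * N\<^sup>2 * Q) else 0) - g * (12 * N * Q) \<le> X j / (1 + (l j)\<^sup>2)" for j
  proof (cases "j = k")
    case True
    have "g * (2 * P\<^sup>2 / M - 12 * N * Q - 20 * N\<^sup>2 * Q) \<le> g * X k" using Xk g by (intro mult_left_mono) auto
    moreover have "g * X k = X k / (1 + (l k)\<^sup>2)" by (simp add: g_def m_def)
    ultimately show ?thesis using True by (simp add: algebra_simps)
  next
    case False
    let ?gj = "1 / (1 + (l j)\<^sup>2)"
    have "0 \<le> 12 * N * Q" using N Q by simp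
    from mult_right_mono[OF gj(2)[of j] this]
    have "- (g * (12 * N * Q)) \<le> - (?gj * (12 * N * Q))" by linarith
    also have "\<dots> = ?gj * - (12 * N * Q)" by simp
    also have "\<dots> \<le> ?gj * X j" using Xj[OF False] gj(1)[of j] by (intro mult_left_mono) auto
    finally show ?thesis using False by simp
  qed
  have "g * (2 * P\<^sup>2 / M - 20 * N\<^sup>2 * Q) - N * (g * (12 * N * Q)) \<le> (\<Sum>j\<in>UNIV. X j / (1 + (l j)\<^sup>2))"
  proof -
    have "(\<Sum>j\<in>UNIV. (if j = k then g * (2 * P\<^sup>2 / M - 20 * N\<^sup>2 * Q) else 0) - g * (12 * N * Q))
        \<le> (\<Sum>j\<in>UNIV. X j / (1 + (l j)\<^sup>2))" by (rule sum_mono) (rule each)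
    thus ?thesis by (simp add: sum_subtractf flip: N_def)
  qed
  moreover have "N * (g * (12 * N * Q)) = g * (12 * N\<^sup>2 * Q)" by (simp add: power2_eq_square mult_ac)
  moreover have "g * (2 * P\<^sup>2 / M - 32 * N\<^sup>2 * Q)
      = g * (2 * P\<^sup>2 / M - 20 * N\<^sup>2 * Q) - g * (12 * N\<^sup>2 * Q)" by (simp add: algebra_simps)
  ultimately have lower: "g * (2 * P\<^sup>2 / M - 32 * N\<^sup>2 * Q) \<le> (\<Sum>j\<in>UNIV. X j / (1 + (l j)\<^sup>2))"
    by (simp only:)
  have upper: "\<eta> * D + (\<Sum>j\<in>UNIV. X j / (1 + (l j)\<^sup>2)) \<le> 0"
  proof -
    have "\<eta> * D + (\<Sum>j\<in>UNIV. X j / (1 + (l j)\<^sup>2)) = (\<Sum>j\<in>UNIV. (\<eta> * T j + X j) / (1 + (l j)\<^sup>2))"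
      unfolding trace[symmetric] by (simp add: sum_distrib_left sum.distrib add_divide_distrib)
    also have "\<dots> \<le> 0"
    proof (intro sum_nonpos divide_nonpos_pos)
      fix j
      show "\<eta> * T j + X j \<le> 0" using second[of j] unfolding X_def B_def by simp
      show "0 < 1 + (l j)\<^sup>2" by (simp add: add_pos_nonneg)
    qed
    finally show ?thesis .
  qed
  have "32 * N\<^sup>2 * Q < P\<^sup>2 / M"
  proof -
    have "32 * N\<^sup>2 * M * P < \<eta> * P * P" using big P by (intro mult_strict_right_mono) auto
    thus ?thesis using M \<eta> unfolding Q_def by (simp add: field_simps power2_eq_square)
  qed
  hence "g * (P\<^sup>2 / M) < g * (2 * P\<^sup>2 / M - 32 * N\<^sup>2 * Q)" using g by (intro mult_strict_left_mono) auto
  also have "\<dots> \<le> - (\<eta> * D)" using lower upper by linarith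
  also have "\<dots> \<le> \<eta> * (4 / m)"
  proof -
    have "- D \<le> 4 / m" using D \<phi>m by simp
    hence "\<eta> * (- D) \<le> \<eta> * (4 / m)" using \<eta> by (intro mult_left_mono) auto
    thus ?thesis by simp
  qed
  finally have "P\<^sup>2 * m < 4 * \<eta> * M * (1 + m\<^sup>2)"
    using m1 M by (simp add: g_def field_simps add_pos_nonneg)
  also have "\<dots> \<le> 4 * \<eta> * M * (2 * m\<^sup>2)"
    using m1 \<eta> M by (intro mult_left_mono) (auto simp: one_le_power)
  also have "\<dots> = 8 * M * (\<eta> * m) * m" by (simp add: power2_eq_square)
  finally have "P\<^sup>2 < 8 * M * (\<eta> * m)" using m1 by simp
  also have "\<dots> \<le> 8 * M * (\<eta> * (Q * (5 * N)))" using m_upper \<eta> M by (intro mult_left_mono) auto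
  also have "\<dots> = 40 * N * M * P" using Q(1) by simp
  finally have "P * P < 40 * N * M * P" by (simp add: power2_eq_square)
  hence "P < 40 * N * M" using P by simp
  moreover have "N * M \<le> N\<^sup>2 * M" using NN M by (intro mult_right_mono) auto
  ultimately show False using P_big NM by linarith
qed

section \<open>The gradient estimate\<close>

text \<open>These are the conditions \<open>v' = 0\<close> and \<open>v'' \<le> 0\<close> along the line through \<open>x\<close> in the direction of an
  eigenvector, for \<open>v = \<eta> (Du \<bullet> \<nu>) + A (u + m)\<^sup>2\<close> with \<open>\<eta>(y) = 1/4 - |y|\<^sup>2\<close>.\<close>
lemma second_order_conditions:
  fixes u :: "real^'n \<Rightarrow> real" and x \<nu> e :: "real^'n" and A m P \<eta> :: real
  defines "\<eta> \<equiv> 1 / 4 - x \<bullet> x"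
  assumes C3: "Ck_on 3 u (ball 0 1)" and x: "norm x < 1 / 2" and e: "norm e = 1"
    and p: "gradient u x = P *\<^sub>R \<nu>" and \<nu>: "norm \<nu> = 1"
    and eig: "hessian u x *v e = l *\<^sub>R e"
    and max: "\<And>y. y \<in> cball 0 (1 / 2) \<Longrightarrow>
       (1 / 4 - y \<bullet> y) * (gradient u y \<bullet> \<nu>) + A * (u y + m)\<^sup>2 \<le> \<eta> * P + A * (u x + m)\<^sup>2"
  shows "\<eta> * (l * (e \<bullet> \<nu>)) + (- 2 * (x \<bullet> e)) * P + 2 * A * (u x + m) * (P * (e \<bullet> \<nu>)) = 0"
    and "\<eta> * (e \<bullet> (hessian_deriv u x \<nu> *v e)) + 2 * (- 2 * (x \<bullet> e)) * (l * (e \<bullet> \<nu>)) - 2 * P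
       + 2 * A * (P * (e \<bullet> \<nu>))\<^sup>2 + 2 * A * (u x + m) * l \<le> 0"
proof -
  define r where "r = 1 / 2 - norm x"
  have r: "0 < r" using x by (simp add: r_def)
  define L where "L t = x + t *\<^sub>R e" for t
  have L_small: "norm (L t) < 1 / 2" if "\<bar>t\<bar> < r" for t
    using norm_triangle_ineq[of x "t *\<^sub>R e"] that e by (simp add: L_def r_def)
  hence L_in: "L t \<in> ball 0 1" if "\<bar>t\<bar> < r" for t
    using that by fastforce
  have L0: "L 0 = x" by (simp add: L_def)
  have x1: "x \<in> ball 0 1" using L_in[of 0] r by (simp add: L0)
  define q where "q t = gradient u (L t) \<bullet> \<nu>" for t
  define q' where "q' t = e \<bullet> (hessian u (L t) *v \<nu>)" for t
  define U where "U t = u (L t) + m" for t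
  define U' where "U' t = gradient u (L t) \<bullet> e" for t
  have dq: "(q has_real_derivative q' t) (at t)" if "\<bar>t\<bar> < r" for t
    unfolding q_def q'_def L_def
    by (rule has_derivative_along_line[OF C3_gradient_has_derivative[OF C3 open_ball]])
       (use L_in[OF that] in \<open>simp add: L_def\<close>)
  have dq': "(q' has_real_derivative e \<bullet> (hessian_deriv u x e *v \<nu>)) (at 0)"
    unfolding q'_def L_def
    by (rule has_derivative_along_line) (use C3_hessian_has_derivative[OF C3 open_ball x1] in simp)
  have dU: "(U has_real_derivative U' t) (at t)" if "\<bar>t\<bar> < r" for t
  proof -
    have "((\<lambda>t. u (x + t *\<^sub>R e)) has_real_derivative gradient u (x + t *\<^sub>R e) \<bullet> e) (at t)"
      by (rule has_derivative_along_line[OF C3_has_gradient[OF C3 open_ball]])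
         (use L_in[OF that] in \<open>simp add: L_def\<close>)
    thus ?thesis unfolding U_def U'_def L_def by (auto intro!: derivative_eq_intros)
  qed
  have dU': "(U' has_real_derivative e \<bullet> (hessian u x *v e)) (at 0)"
    unfolding U'_def L_def
    by (rule has_derivative_along_line) (use C3_gradient_has_derivative[OF C3 open_ball x1] in simp)
  define c where "c = - 2 * (x \<bullet> e)"
  define E where "E t = \<eta> + c * t - t\<^sup>2" for t
  have E: "1 / 4 - L t \<bullet> L t = E t" for t
    using e by (simp add: L_def E_def \<eta>_def c_def inner_add_left inner_add_right norm_eq_1
        power2_eq_square inner_commute algebra_simps)
  define f where "f t = E t * q t + A * (U t)\<^sup>2" for t
  define f' where "f' t = (c - 2 * t) * q t + E t * q' t + 2 * A * (U t * U' t)" for t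
  have dE: "(E has_real_derivative c - 2 * t) (at t)" for t
    unfolding E_def by (auto intro!: derivative_eq_intros)
  have df: "(f has_real_derivative f' t) (at t)" if "\<bar>t\<bar> < r" for t
    unfolding f_def f'_def
    by (auto intro!: derivative_eq_intros dE dq dU that simp: algebra_simps power2_eq_square)
  define d where "d = - 2 * q 0 + 2 * c * q' 0 + E 0 * (e \<bullet> (hessian_deriv u x e *v \<nu>))
      + 2 * A * (U' 0 * U' 0 + U 0 * (e \<bullet> (hessian u x *v e)))"
  have df': "(f' has_real_derivative d) (at 0)"
    unfolding f'_def d_def using r
    by (auto intro!: derivative_eq_intros dE dq dq' dU dU' simp: algebra_simps)
  have fmax: "f t \<le> f 0" if "\<bar>t\<bar> < r" for t
  proof -
    have "f t \<le> \<eta> * P + A * (u x + m)\<^sup>2"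
      using max[of "L t"] L_small[OF that] by (simp add: f_def q_def U_def E)
    also have "\<dots> = f 0"
      using p \<nu> by (simp add: f_def q_def U_def E_def L0 norm_eq_1)
    finally show ?thesis .
  qed
  note conds = local_max_second_derivative[OF r df df' fmax]
  have vals: "q 0 = P" "q' 0 = l * (e \<bullet> \<nu>)" "U 0 = u x + m" "U' 0 = P * (e \<bullet> \<nu>)" "E 0 = \<eta>"
    using p \<nu> eig C3_hessian_selfadjoint[OF C3 open_ball x1, of e \<nu>]
    by (simp_all add: q_def q'_def U_def U'_def E_def L0 norm_eq_1 inner_commute)
  have ee: "e \<bullet> e = 1" using e by (simp add: norm_eq_1)
  show "\<eta> * (l * (e \<bullet> \<nu>)) + (- 2 * (x \<bullet> e)) * P + 2 * A * (u x + m) * (P * (e \<bullet> \<nu>)) = 0"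
    using conds(1) unfolding f'_def vals c_def by (simp add: algebra_simps)
  show "\<eta> * (e \<bullet> (hessian_deriv u x \<nu> *v e)) + 2 * (- 2 * (x \<bullet> e)) * (l * (e \<bullet> \<nu>)) - 2 * P
       + 2 * A * (P * (e \<bullet> \<nu>))\<^sup>2 + 2 * A * (u x + m) * l \<le> 0"
    using conds(2) unfolding d_def vals eig C3_third_derivative_symmetric[OF C3 open_ball x1]
    by (simp add: c_def ee algebra_simps power2_eq_square)
qed

text \<open>The differentiated equation \<open>F\<^sub>i\<^sub>j u\<^sub>i\<^sub>j\<^sub>\<nu> = \<psi>\<^sub>\<nu>\<close> in a basis diagonalizing the Hessian, where the
  coefficients \<open>(I + (D\<^sup>2u)\<^sup>2)\<^sup>-\<^sup>1\<close> are \<open>1 / (1 + l\<^sub>k\<^sup>2)\<close>.\<close>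
lemma trace_linearized:
  fixes u \<psi> :: "real^'n \<Rightarrow> real" and e :: "'n \<Rightarrow> real^'n" and l :: "'n \<Rightarrow> real"
  assumes C3: "Ck_on 3 u S" and S: "open S" and x: "x \<in> S"
    and \<psi>: "(\<psi> has_derivative D) (at x)"
    and eq: "\<And>y. y \<in> S \<Longrightarrow> (\<Sum>l\<in>#eigenvalues (hessian u y). arctan l) = \<psi> y"
    and on: "\<And>i j. e i \<bullet> e j = (if i = j then 1 else 0)"
    and eig: "\<And>i. hessian u x *v e i = l i *\<^sub>R e i"
  shows "(\<Sum>k\<in>UNIV. (e k \<bullet> (hessian_deriv u x \<nu> *v e k)) / (1 + (l k)\<^sup>2)) = D \<nu>"
proof -
  have ev: "\<forall>\<^sub>F t in nhds 0. x + t *\<^sub>R \<nu> \<in> S"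
  proof -
    have "((\<lambda>t. x + t *\<^sub>R \<nu>) \<longlongrightarrow> x + 0 *\<^sub>R \<nu>) (nhds 0)"
      by (intro tendsto_intros filterlim_ident)
    thus ?thesis using topological_tendstoD[OF _ S] x by simp
  qed
  show ?thesis
  proof (rule phase_derivative[where H = "\<lambda>t. hessian u (x + t *\<^sub>R \<nu>)" and \<theta> = "\<lambda>t. \<psi> (x + t *\<^sub>R \<nu>)"])
    show "\<forall>\<^sub>F t in nhds 0. \<forall>i j. hessian u (x + t *\<^sub>R \<nu>) $ i $ j = hessian u (x + t *\<^sub>R \<nu>) $ j $ i"
      using ev by eventually_elim (blast intro: C3_hessian_symmetric[OF C3 S])
    show "\<forall>\<^sub>F t in nhds 0. (\<Sum>l\<in>#eigenvalues (hessian u (x + t *\<^sub>R \<nu>)). arctan l) = \<psi> (x + t *\<^sub>R \<nu>)"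
      using ev by eventually_elim (rule eq)
    show "((\<lambda>t. hessian u (x + t *\<^sub>R \<nu>) $ i $ j) has_real_derivative hessian_deriv u x \<nu> $ i $ j) (at 0)" for i j
      by (rule has_derivative_along_line) (use C3_hessian_entry_has_derivative[OF C3 S x] in simp)
    show "((\<lambda>t. \<psi> (x + t *\<^sub>R \<nu>)) has_real_derivative D \<nu>) (at 0)"
      by (rule has_derivative_along_line) (use \<psi> in simp)
    show "hessian u (x + 0 *\<^sub>R \<nu>) *v e i = l i *\<^sub>R e i" for i using eig by simp
  qed (rule on)
qed


lemma Ck_closure_bounds:
  fixes u :: "real^'n \<Rightarrow> real"
  assumes "Ck_closure k u (ball 0 1)" and x: "x \<in> ball 0 1"
  shows "(INF y\<in>ball 0 1. u y) \<le> u x" "u x \<le> (INF y\<in>ball 0 1. u y) + osc (ball 0 1) u"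
proof -
  have "continuous_on (cball 0 1) u" using assms(1) by (simp add: Ck_closure_def)
  hence "bounded (u ` cball 0 1)" by (intro compact_imp_bounded compact_continuous_image compact_cball)
  hence "bounded (u ` ball 0 1)" by (rule bounded_subset) (intro image_mono ball_subset_cball)
  note bdd = bounded_imp_bdd_above[OF this] bounded_imp_bdd_below[OF this]
  show "(INF y\<in>ball 0 1. u y) \<le> u x" by (rule cINF_lower[OF bdd(2) x])
  show "u x \<le> (INF y\<in>ball 0 1. u y) + osc (ball 0 1) u"
    using cSUP_upper[OF x bdd(1)] by (simp add: osc_def)
qed

text \<open>With \<open>\<nu>\<close> frozen to the direction of \<open>Du\<close> at the maximum point \<open>x\<close> of \<open>w\<close>, the function with
  \<open>Du \<bullet> \<nu>\<close> in place of \<open>|Du|\<close> lies below \<open>w\<close> and agrees with it at \<open>x\<close>.  It has a maximum there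
  too, and \<open>|Du|\<close> never has to be differentiated.\<close>
lemma interior_maximum_bound:
  fixes u \<psi> :: "real^'n \<Rightarrow> real" and m M :: real and x :: "real^'n"
  defines "N \<equiv> real CARD('n)"
  defines "w \<equiv> \<lambda>y. (1 / 4 - y \<bullet> y) * norm (gradient u y) + N / M * (u y + m)\<^sup>2"
  assumes \<psi>: "Ck_on 1 \<psi> (ball 0 1)"
    and nonneg: "\<And>y. y \<in> ball 0 1 \<Longrightarrow> 0 \<le> \<psi> y - (N - 2) * (pi / 2)"
    and sup: "infinity_supersolution (\<lambda>y. \<psi> y - (N - 2) * (pi / 2)) (ball 0 1)"
    and C3: "Ck_on 3 u (ball 0 1)"
    and eq: "\<And>y. y \<in> ball 0 1 \<Longrightarrow> (\<Sum>l\<in>#eigenvalues (hessian u y). arctan l) = \<psi> y"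
    and M: "1 \<le> M" and U: "M \<le> u x + m" "u x + m \<le> 2 * M"
    and x: "norm x < 1 / 2"
    and max: "\<And>y. y \<in> cball 0 (1 / 2) \<Longrightarrow> w y \<le> w x"
  shows "(1 / 4 - x \<bullet> x) * norm (gradient u x) \<le> 32 * N\<^sup>2 * M"
proof (cases "gradient u x = 0")
  case True
  then show ?thesis using M by (simp add: N_def)
next
  case False
  define \<eta> where "\<eta> = 1 / 4 - x \<bullet> x"
  have "x \<bullet> x < (1 / 2)\<^sup>2"
    using x by (metis norm_ge_zero power2_norm_eq_inner power_strict_mono zero_less_numeral)
  hence \<eta>: "0 < \<eta>" "\<eta> \<le> 1 / 4" by (simp_all add: \<eta>_def power2_eq_square)
  have x1: "x \<in> ball 0 1" using x by simp
  define P where "P = norm (gradient u x)"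
  have P: "0 < P" using False by (simp add: P_def)
  define \<nu> where "\<nu> = gradient u x /\<^sub>R P"
  have \<nu>: "norm \<nu> = 1" and p: "gradient u x = P *\<^sub>R \<nu>" using P by (simp_all add: \<nu>_def P_def)
  obtain e :: "'n \<Rightarrow> real^'n" and l where on: "\<And>i j. e i \<bullet> e j = (if i = j then 1 else 0)"
    and eig: "\<And>i. hessian u x *v e i = l i *\<^sub>R e i"
    using symmetric_matrix_eigenbasis[of "hessian u x", OF C3_hessian_symmetric[OF C3 open_ball x1]] by blast
  have ne: "norm (e k) = 1" for k using on[of k k] by (simp add: norm_eq_1)
  have lmax: "(1 / 4 - y \<bullet> y) * (gradient u y \<bullet> \<nu>) + N / M * (u y + m)\<^sup>2
      \<le> (1 / 4 - x \<bullet> x) * P + N / M * (u x + m)\<^sup>2" if y: "y \<in> cball 0 (1 / 2)" for y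
  proof -
    have "(norm y)\<^sup>2 \<le> (1 / 2)\<^sup>2" using y by (intro power_mono) auto
    hence "0 \<le> 1 / 4 - y \<bullet> y" unfolding power2_norm_eq_inner by (simp add: power2_eq_square)
    moreover have "gradient u y \<bullet> \<nu> \<le> norm (gradient u y)"
      using norm_cauchy_schwarz[of "gradient u y" \<nu>] \<nu> by simp
    ultimately have "(1 / 4 - y \<bullet> y) * (gradient u y \<bullet> \<nu>) \<le> (1 / 4 - y \<bullet> y) * norm (gradient u y)"
      by (rule mult_left_mono[rotated])
    thus ?thesis using max[OF y] unfolding w_def P_def by linarith
  qed
  note conds = second_order_conditions[OF C3 x ne p \<nu> eig lmax]
  define \<phi> where "\<phi> = \<psi> x - (N - 2) * (pi / 2)"
  have "iter_partial [] \<psi> differentiable (at x)" using \<psi> x1 unfolding Ck_on_def by fastforce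
  hence D: "(\<psi> has_derivative (\<lambda>h. gradient \<psi> x \<bullet> h)) (at x)"
    by (intro differentiable_has_gradient) simp
  hence D': "((\<lambda>y. \<psi> y - (N - 2) * (pi / 2)) has_derivative (\<lambda>h. gradient \<psi> x \<bullet> h)) (at x)"
    by (auto intro!: derivative_eq_intros)
  have sub: "cball x (1 / 4) \<subseteq> ball 0 1"
  proof
    fix y assume "y \<in> cball x (1 / 4)"
    hence "norm (y - x) \<le> 1 / 4" by (simp add: dist_norm norm_minus_commute)
    thus "y \<in> ball 0 1" using x norm_triangle_ineq[of x "y - x"] by simp
  qed
  have "- (4 * \<phi>) \<le> gradient \<psi> x \<bullet> \<nu>"
    using infinity_supersolution_gradient[OF sup open_ball sub _ nonneg[OF subsetD[OF sub]] D' \<nu>]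
    by (simp add: \<phi>_def)
  moreover have "(\<Sum>k\<in>UNIV. (e k \<bullet> (hessian_deriv u x \<nu> *v e k)) / (1 + (l k)\<^sup>2)) = gradient \<psi> x \<bullet> \<nu>"
    by (rule trace_linearized[OF C3 open_ball x1 D eq on eig])
  moreover have "(\<Sum>k\<in>UNIV. arctan (l k)) = (N - 2) * (pi / 2) + \<phi>"
    using eq[OF x1] by (simp add: \<phi>_def eigenvalues_eigenbasis[OF on eig] image_mset.compositionality
        o_def sum_unfold_sum_mset)
  moreover have "0 \<le> \<phi>" using nonneg[OF x1] by (simp add: \<phi>_def)
  moreover have "(\<Sum>k\<in>UNIV. (e k \<bullet> \<nu>)\<^sup>2) = 1"
    using orthonormal_expansion[OF on, of \<nu> \<nu>] \<nu> by (simp add: power2_eq_square norm_eq_1)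
  moreover have "\<bar>- 2 * (x \<bullet> e k)\<bar> \<le> 1" for k
    using Cauchy_Schwarz_ineq2[of x "e k"] ne[of k] x by (simp add: abs_mult)
  ultimately have "\<eta> * P \<le> 32 * N\<^sup>2 * M"
    unfolding N_def
    by (intro critical_point_estimate[OF \<eta> P M U _ _ conds[unfolded N_def, folded \<eta>_def]])
       (simp_all add: N_def)
  thus ?thesis by (simp add: \<eta>_def P_def)
qed

theorem mainTheorem6:
  shows "\<exists>C::real. \<forall>(\<psi>::real^'n::finite \<Rightarrow> real) (u::real^'n \<Rightarrow> real).
    Ck_on 1 \<psi> (ball 0 1) \<longrightarrow>
    (\<forall>x\<in>ball 0 1. 0 \<le> \<psi> x - (real CARD('n) - 2) * (pi / 2)) \<longrightarrow>
    infinity_supersolution (\<lambda>x. \<psi> x - (real CARD('n) - 2) * (pi / 2)) (ball 0 1) \<longrightarrow>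
    Ck_closure 3 u (ball 0 1) \<longrightarrow>
    (\<forall>x\<in>ball 0 1. (\<Sum>l\<in>#eigenvalues (hessian u x). arctan l) = \<psi> x) \<longrightarrow>
    norm (gradient u 0) \<le> C * (1 + osc (ball 0 1) u)"
proof (intro exI[of _ "144 * (real CARD('n))\<^sup>2"] allI impI)
  fix \<psi> u :: "real^'n \<Rightarrow> real"
  assume \<psi>: "Ck_on 1 \<psi> (ball 0 1)"
    and nonneg: "\<forall>x\<in>ball 0 1. 0 \<le> \<psi> x - (real CARD('n) - 2) * (pi / 2)"
    and sup: "infinity_supersolution (\<lambda>x. \<psi> x - (real CARD('n) - 2) * (pi / 2)) (ball 0 1)"
    and u: "Ck_closure 3 u (ball 0 1)"
    and eq: "\<forall>x\<in>ball 0 1. (\<Sum>l\<in>#eigenvalues (hessian u x). arctan l) = \<psi> x"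
  define N where "N = real CARD('n)"
  have N: "1 \<le> N" by (simp add: N_def Suc_le_eq)
  have C3: "Ck_on 3 u (ball 0 1)" using u by (simp add: Ck_closure_def)
  define M where "M = 1 + osc (ball 0 1) u"
  define m where "m = M - (INF y\<in>ball 0 1. u y)"
  note bounds = Ck_closure_bounds[OF u]
  have M: "1 \<le> M" using bounds[of 0] by (simp add: M_def)
  have U: "M \<le> u x + m" "u x + m \<le> 2 * M" if "x \<in> ball 0 1" for x
    using bounds[OF that] by (simp_all add: m_def M_def)
  define w where "w y = (1 / 4 - y \<bullet> y) * norm (gradient u y) + N / M * (u y + m)\<^sup>2" for y
  have sub: "cball 0 (1 / 2) \<subseteq> ball (0::real^'n) 1" by auto
  have "continuous_on (ball 0 1) (gradient u)"
  proof -
    have "continuous_on (ball 0 1) (iter_partial [i] u)" for i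
      using C3 unfolding Ck_on_def by (elim conjE allE[of _ "[i]"]) simp
    thus ?thesis unfolding gradient_def by (intro continuous_on_vec_lambda) simp
  qed
  moreover have "continuous_on (ball 0 1) u"
  proof -
    have "continuous_on (ball 0 1) (iter_partial [] u)"
      using C3 unfolding Ck_on_def by (elim conjE allE[of _ "[]"]) simp
    thus ?thesis by simp
  qed
  ultimately have "continuous_on (cball 0 (1 / 2)) w"
    unfolding w_def by (intro continuous_intros continuous_on_subset[OF _ sub])
  then obtain x where x: "x \<in> cball 0 (1 / 2)" and max: "\<And>y. y \<in> cball 0 (1 / 2) \<Longrightarrow> w y \<le> w x"
    using continuous_attains_sup[of "cball (0::real^'n) (1 / 2)" w] by auto
  have x1: "x \<in> ball 0 1" using x sub by blast
  have "(1 / 4 - x \<bullet> x) * norm (gradient u x) \<le> 32 * N\<^sup>2 * M"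
  proof (cases "norm x < 1 / 2")
    case True
    show ?thesis
      using interior_maximum_bound[of \<psi> u M x m] \<psi> nonneg sup C3 eq M U[OF x1] True max
      unfolding w_def N_def by blast
  next
    case False
    hence "norm x = 1 / 2" using x by simp
    hence "x \<bullet> x = (1 / 2)\<^sup>2" by (metis power2_norm_eq_inner)
    hence zero: "1 / 4 - x \<bullet> x = 0" by (simp add: power2_eq_square)
    show ?thesis unfolding zero using M by simp
  qed
  moreover have "N / M * (u x + m)\<^sup>2 \<le> 4 * N\<^sup>2 * M"
  proof -
    have "(u x + m)\<^sup>2 \<le> (2 * M)\<^sup>2" using U[OF x1] M by (intro power_mono) auto
    hence "N / M * (u x + m)\<^sup>2 \<le> N / M * (2 * M)\<^sup>2" using N M by (intro mult_left_mono) auto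
    also have "\<dots> = 4 * N * M" using M by (simp add: power2_eq_square)
    also have "\<dots> \<le> 4 * N\<^sup>2 * M"
      using N M by (intro mult_right_mono) (auto simp: power2_eq_square)
    finally show ?thesis .
  qed
  ultimately have "w x \<le> 36 * N\<^sup>2 * M" by (simp add: w_def)
  hence "w 0 \<le> 36 * N\<^sup>2 * M" using max[of 0] by simp
  moreover have "1 / 4 * norm (gradient u 0) \<le> w 0" using N M by (simp add: w_def)
  ultimately have "norm (gradient u 0) \<le> 144 * N\<^sup>2 * M" by linarith
  thus "norm (gradient u 0) \<le> 144 * (real CARD('n))\<^sup>2 * (1 + osc (ball 0 1) u)"
    by (simp add: N_def M_def)
qed

end
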